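(* A natural number $p>1$ is prime if and only if $\binom{q}{p}-\left\lfloor \frac{q}{p}\right\rfloor$ is divisible by $p$ for every prime number $q$.
   Context: $\binom{q}{p}$ is the number of ways to choose $p$ elements out of $q$ elements (so it is $0$ when $q<p$), and $\lfloor x\rfloor$ is the greatest integer not exceeding the real number $x$. *)

theory Defs
  imports Complex_Main "HOL-Computational_Algebra.Primes"
begin

end

theory Submission
  imports Defs "HOL-Computational_Algebra.Squarefree" "HOL-Number_Theory.Number_Theory"
begin

text \<open>
  For prime \<open>p\<close>, Vandermonde's identity gives \<open>(q + p choose p) \<equiv> (q choose p) + 1\<close> modulo \<open>p\<close>, hence
  \<open>(q choose p) \<equiv> q div p\<close> for every \<open>q\<close>. For composite \<open>n\<close> with smallest prime factor \<open>r\<close>, the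
  congruence fails at suitable arguments: at \<open>-1\<close> if \<open>n\<close> is even, and at \<open>n + r + 1\<close> if \<open>n\<close> is odd,
  where \<open>n + r + 1 choose n\<close> is \<open>1 + n / r\<close> modulo the exact power of \<open>r\<close> dividing \<open>n\<close>. Modulo \<open>n\<close>,
  both sides depend only on the residue class of \<open>q\<close> modulo a suitable multiple of \<open>n\<close>, so these
  arguments may be replaced by a prime in their class, which exists by Dirichlet's theorem. The latter is proved in the elementary way of Mertens and
  Shapiro, by estimating \<open>\<Sum>n\<le>N. \<chi> n * mangoldt n / n\<close> for the Dirichlet characters \<open>\<chi>\<close>.
\<close>

section \<open>Divisor sums and the Moebius function\<close>

text \<open>Since only prime \<open>q\<close> are allowed, a residue at which the congruence fails
  is usable only if it is coprime to the modulus. This forces the split by parity. The residue -1 is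
  always coprime, but for odd \<open>n\<close> both sides are -1 there. The residue
  \<open>n + r + 1\<close> is coprime to \<open>n\<close> when \<open>n\<close> is odd: a common
  prime factor is at least \<open>r\<close> and divides \<open>r + 1\<close>, so it would be the
  even number \<open>r + 1\<close>. For \<open>r = 2\<close> it can share the factor 3 with
  \<open>n\<close>. The hard point of Dirichlet's theorem is that \<open>L(1, \<chi>)\<close> is
  nonzero. A zero makes the von Mangoldt sum of \<chi> behave like \<open>- ln N\<close>. For a
  nonreal \<chi> the conjugate contributes the same, and \<open>- 2 * ln N\<close> outweighs the
  crude bound \<open>3 / 2 * ln N\<close> for the principal character, although the sum over all
  characters is nonnegative. A real \<chi> is its own conjugate and would contribute only once,
  hence the separate hyperbola argument.\<close>

lemma sum_divisors_prime_power_mult: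
  fixes p m k :: nat and g :: "nat \<Rightarrow> 'a :: comm_monoid_add"
  assumes p: "prime p" "\<not> p dvd m" "m > 0"
  shows "(\<Sum>d | d dvd p ^ k * m. g d) = (\<Sum>i\<le>k. \<Sum>d | d dvd m. g (p ^ i * d))"
proof -
  have mult: "multiplicity p (p ^ i * d) = i" if "d dvd m" for i d
  proof -
    have "\<not> p dvd d" "d \<noteq> 0" "p \<noteq> 0" "\<not> is_unit p" using that p dvd_trans by (auto intro: dvd_trans)
    then show ?thesis by (intro multiplicity_eqI) (auto simp: power_Suc)
  qed
  have inj: "inj_on (\<lambda>(i, d). p ^ i * d) ({..k} \<times> {d. d dvd m})"
  proof (rule inj_onI, clarify)
    fix i d j e assume *: "d dvd m" "e dvd m" "p ^ i * d = p ^ j * e"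
    then have "i = j" using mult by metis
    then show "i = j \<and> d = e" using * p by (auto simp: prime_gt_0_nat)
  qed
  have img: "(\<lambda>(i, d). p ^ i * d) ` ({..k} \<times> {d. d dvd m}) = {d. d dvd p ^ k * m}"
  proof (intro equalityI subsetI)
    fix x assume "x \<in> {d. d dvd p ^ k * m}"
    then obtain b c where bc: "x = b * c" "b dvd p ^ k" "c dvd m"
      using division_decomp[of x "p ^ k" m] by auto
    from bc(2) p obtain i where "i \<le> k" "b = p ^ i" using divides_primepow_nat[of p b k] by auto
    then show "x \<in> (\<lambda>(i, d). p ^ i * d) ` ({..k} \<times> {d. d dvd m})" using bc by force
  qed (auto intro!: mult_dvd_mono le_imp_power_dvd)
  have "(\<Sum>d | d dvd p ^ k * m. g d) = (\<Sum>x\<in>{..k} \<times> {d. d dvd m}. g (case x of (i, d) \<Rightarrow> p ^ i * d))"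
    unfolding img[symmetric] by (subst sum.reindex[OF inj]) (simp add: o_def)
  also have "\<dots> = (\<Sum>i\<le>k. \<Sum>d | d dvd m. g (p ^ i * d))"
    by (simp add: sum.cartesian_product split_def)
  finally show ?thesis .
qed

text \<open>Induction for multiplicative functions: removing the full power of one prime leaves a
  cofactor coprime to it, so \<open>sum_divisors_prime_power_mult\<close> applies at each
  step.\<close>

lemma prime_power_factor_induct [consumes 1, case_names one prime_power]:
  fixes n :: nat
  assumes "n > 0" and "P 1"
    and step: "\<And>p k m. prime p \<Longrightarrow> k > 0 \<Longrightarrow> m > 0 \<Longrightarrow> \<not> p dvd m \<Longrightarrow> P m \<Longrightarrow> P (p ^ k * m)"
  shows "P n"
  using assms(1)
proof (induction n rule: less_induct)
  case (less n)
  show ?case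
  proof (cases "n = 1")
    case False
    then obtain p where p: "prime p" "p dvd n" using prime_factor_nat by blast
    with less.prems obtain m where m: "n = p ^ multiplicity p n * m" "\<not> p dvd m"
      using multiplicity_decompose'[of n p] prime_gt_1_nat[OF p(1)]
      by (metis less_irrefl nat_dvd_1_iff_1 less.prems)
    have k: "multiplicity p n > 0" using p less.prems by (simp add: prime_multiplicity_gt_zero_iff)
    have m0: "m > 0" using m less.prems by (cases m) auto
    have "1 * m < p ^ multiplicity p n * m"
      using m0 k p(1) by (intro mult_strict_right_mono one_less_power prime_gt_1_nat) auto
    then have "m < n" using m(1) by simp
    then show ?thesis using step[OF p(1) k m0 m(2) less.IH] m m0 by metis
  qed (use assms in simp)
qed

definition moebius :: "nat \<Rightarrow> real" where
  "moebius n = (if squarefree n then (-1) ^ card (prime_factors n) else 0)"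

lemma moebius_1 [simp]: "moebius (Suc 0) = 1"
  by (simp add: moebius_def)

lemma abs_moebius_le: "\<bar>moebius n\<bar> \<le> 1"
  by (simp add: moebius_def)

lemma moebius_prime_mult:
  assumes "prime p" "\<not> p dvd m"
  shows "moebius (p * m) = - moebius m"
proof -
  have m: "m \<noteq> 0" using assms by (cases m) auto
  have "coprime p m" using assms by (simp add: prime_imp_coprime)
  moreover have "prime_factors (p * m) = insert p (prime_factors m)"
    using assms m by (auto simp: prime_factors_product prime_prime_factors)
  moreover have "p \<notin> prime_factors m" using assms by auto
  ultimately show ?thesis using assms
    by (auto simp: moebius_def squarefree_mult_coprime squarefree_prime
             dest: squarefree_multD)
qed

lemma moebius_prime_power_mult:
  assumes "prime p" "i \<ge> 2"
  shows "moebius (p ^ i * m) = 0"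
proof -
  have "p\<^sup>2 dvd p ^ i * m" using assms by (meson dvd_mult2 le_imp_power_dvd)
  moreover have "\<not> is_unit p" using assms by (simp add: prime_nat_iff)
  ultimately show ?thesis unfolding moebius_def squarefree_def by auto
qed

text \<open>For \<open>d\<close> dividing \<open>m\<close>, the divisors \<open>d\<close> and
  \<open>p * d\<close> cancel in pairs, and divisors containing \<open>p\<^sup>2\<close> contribute
  0.\<close>

lemma sum_moebius_divisors:
  assumes "n > 0"
  shows "(\<Sum>d | d dvd n. moebius d) = (if n = 1 then 1 else 0)"
  using assms
proof (induction n rule: prime_power_factor_induct)
  case (prime_power p k m)
  have "(\<Sum>i\<le>k. \<Sum>d | d dvd m. moebius (p ^ i * d)) = (\<Sum>i\<in>{0,1}. \<Sum>d | d dvd m. moebius (p ^ i * d))"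
    using prime_power by (intro sum.mono_neutral_right) (auto intro!: sum.neutral moebius_prime_power_mult)
  also have "\<dots> = (\<Sum>d | d dvd m. moebius d + moebius (p * d))"
    by (simp add: sum.distrib)
  also have "\<dots> = 0"
  proof (intro sum.neutral ballI)
    fix d assume "d \<in> {d. d dvd m}"
    then have "\<not> p dvd d" using prime_power dvd_trans by blast
    then show "moebius d + moebius (p * d) = 0" using prime_power by (simp add: moebius_prime_mult)
  qed
  finally have "(\<Sum>d | d dvd p ^ k * m. moebius d) = 0"
    using prime_power by (simp add: sum_divisors_prime_power_mult)
  moreover have "p ^ k * m \<noteq> 1" using prime_power by (auto simp: prime_nat_iff)
  ultimately show ?case by simp
qed auto

text \<open>Both sides range over the pairs with \<open>d * e\<close> dividing \<open>n\<close>, a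
  condition symmetric in \<open>d\<close> and \<open>e\<close>.\<close>

lemma sum_divisor_pairs_swap:
  fixes f :: "nat \<Rightarrow> nat \<Rightarrow> 'a :: comm_monoid_add"
  assumes "n > 0"
  shows "(\<Sum>d | d dvd n. \<Sum>e | e dvd n div d. f d e) = (\<Sum>e | e dvd n. \<Sum>d | d dvd n div e. f d e)"
proof -
  have "d dvd n \<and> e dvd n div d \<longleftrightarrow> e dvd n \<and> d dvd n div e" for d e
  proof -
    have "d dvd n \<and> e dvd n div d \<longleftrightarrow> d * e dvd n" for d e
      using assms by (cases "d = 0") (auto simp: dvd_div_iff_mult mult.commute intro: dvd_mult_left)
    then show ?thesis by (metis mult.commute)
  qed
  note iff = this
  have fin: "finite {d. d dvd n}" using assms by simp
  have "(\<Sum>d | d dvd n. \<Sum>e | e dvd n div d. f d e) = (\<Sum>d | d dvd n. \<Sum>e | e dvd n \<and> e dvd n div d. f d e)"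
    using assms iff by (intro sum.cong) auto
  also have "\<dots> = (\<Sum>e | e dvd n. \<Sum>d | d dvd n \<and> e dvd n div d. f d e)"
    using sum.swap_restrict[OF fin fin, of f "\<lambda>d e. e dvd n div d"] by simp
  also have "\<dots> = (\<Sum>e | e dvd n. \<Sum>d | d dvd n div e. f d e)"
    using assms iff by (intro sum.cong) auto
  finally show ?thesis .
qed

text \<open>Moebius inversion of \<open>mangoldt_sum\<close>: once \<open>ln\<close> is expanded and
  the sums are exchanged, \<open>sum_moebius_divisors\<close> leaves only
  \<open>e = n\<close>.\<close>

lemma sum_moebius_ln_divisors:
  assumes "n > 0"
  shows "(\<Sum>d | d dvd n. moebius d * ln (real (n div d))) = mangoldt n"
proof -
  have "(\<Sum>d | d dvd n. moebius d * ln (real (n div d))) = (\<Sum>d | d dvd n. \<Sum>e | e dvd n div d. moebius d * mangoldt e)"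
  proof (rule sum.cong)
    fix d assume "d \<in> {d. d dvd n}"
    then have "n div d \<noteq> 0" using assms by auto
    from mangoldt_sum[OF this, where 'a = real]
    show "moebius d * ln (real (n div d)) = (\<Sum>e | e dvd n div d. moebius d * mangoldt e)"
      by (simp only: sum_distrib_left[symmetric]) simp
  qed simp
  also have "\<dots> = (\<Sum>e | e dvd n. \<Sum>d | d dvd n div e. moebius d * mangoldt e)"
    by (rule sum_divisor_pairs_swap[OF assms])
  also have "\<dots> = (\<Sum>e | e dvd n. (if e = n then mangoldt e else 0))"
  proof (rule sum.cong)
    fix e assume e: "e \<in> {e. e dvd n}"
    then have "n div e > 0" using assms by auto
    from sum_moebius_divisors[OF this] e assms
    show "(\<Sum>d | d dvd n div e. moebius d * mangoldt e) = (if e = n then mangoldt e else 0)"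
      by (auto simp: sum_distrib_right[symmetric] elim!: dvdE)
  qed simp
  also have "\<dots> = mangoldt n" using assms by (simp add: sum.delta)
  finally show ?thesis .
qed

text \<open>Writing \<open>n = d * k\<close> matches the pairs of \<open>n\<close> and a divisor
  \<open>d\<close> with the lattice points under the hyperbola \<open>d * k \<le> N\<close>. This
  turns sums of Dirichlet convolutions into double sums.\<close>

lemma sum_up_to_divisors:
  fixes F :: "nat \<Rightarrow> nat \<Rightarrow> 'a :: comm_monoid_add"
  shows "(\<Sum>n = 1..N. \<Sum>d | d dvd n. F d (n div d)) = (\<Sum>d = 1..N. \<Sum>k = 1..N div d. F d k)"
proof -
  have le_N: "b \<le> N" if "b * k \<le> N" "k > 0" for b k :: nat
    using that by (metis Suc_leI le_trans mult.right_neutral mult_le_mono2 One_nat_def)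
  have "(\<Sum>n = 1..N. \<Sum>d | d dvd n. F d (n div d))
      = (\<Sum>(n, d)\<in>(SIGMA n:{1..N}. {d. d dvd n}). F d (n div d))"
    by (rule sum.Sigma) auto
  also have "\<dots> = (\<Sum>(d, k)\<in>(SIGMA d:{1..N}. {1..N div d}). F d k)"
    by (rule sum.reindex_bij_witness[of _ "\<lambda>(d, k). (d * k, d)" "\<lambda>(n, d). (d, n div d)"])
       (auto simp: div_le_mono Suc_le_eq less_eq_div_iff_mult_less_eq mult.commute
             dest: dvd_imp_le le_N elim!: dvdE)
  also have "\<dots> = (\<Sum>d = 1..N. \<Sum>k = 1..N div d. F d k)"
    by (rule sum.Sigma[symmetric]) auto
  finally show ?thesis .
qed

section \<open>Dirichlet characters\<close>

text \<open>Characters of the unit group modulo \<open>M\<close>, extended by 0 to a periodic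
  function on the naturals. Nonvanishing on units forces the value 1 at 1, and Euler's theorem then
  makes all nonzero values roots of unity.\<close>

definition dchars :: "nat \<Rightarrow> (nat \<Rightarrow> complex) set" where
  "dchars M = {\<chi>. (\<forall>a b. \<chi> (a * b) = \<chi> a * \<chi> b) \<and> (\<forall>a. \<chi> (a mod M) = \<chi> a)
                 \<and> (\<forall>a. \<chi> a \<noteq> 0 \<longleftrightarrow> coprime a M)}"

definition principal_dchar :: "nat \<Rightarrow> nat \<Rightarrow> complex" where
  "principal_dchar M a = (if coprime a M then 1 else 0)"

lemma principal_dchar_in_dchars:
  assumes "M > 0"
  shows "principal_dchar M \<in> dchars M"
proof -
  have "coprime (a mod M) M \<longleftrightarrow> coprime a M" for a using assms by simp
  then show ?thesis unfolding dchars_def principal_dchar_def by simp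
qed

context
  fixes M :: nat and \<chi> :: "nat \<Rightarrow> complex"
  assumes \<chi>: "\<chi> \<in> dchars M"
begin

lemma dchar_mult: "\<chi> (a * b) = \<chi> a * \<chi> b"
  and dchar_mod [simp]: "\<chi> (a mod M) = \<chi> a"
  and dchar_eq_0_iff: "\<chi> a = 0 \<longleftrightarrow> \<not> coprime a M"
  using \<chi> unfolding dchars_def by blast+

lemma dchar_cong: "[a = b] (mod M) \<Longrightarrow> \<chi> a = \<chi> b"
  by (metis cong_def dchar_mod)

lemma dchar_1 [simp]: "\<chi> (Suc 0) = 1"
  using dchar_mult[of 1 1] dchar_eq_0_iff[of 1] by simp

lemma dchar_power: "\<chi> (a ^ k) = \<chi> a ^ k"
  by (induction k) (auto simp: dchar_mult)

lemma dchar_root_of_unity: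
  assumes "coprime a M"
  shows "\<chi> a ^ totient M = 1"
  using dchar_cong[OF euler_theorem[OF assms]] by (simp add: dchar_power)

lemma norm_dchar:
  assumes "M > 0" "coprime a M"
  shows "norm (\<chi> a) = 1"
proof (rule power_eq_imp_eq_base)
  show "norm (\<chi> a) ^ totient M = 1 ^ totient M"
    using dchar_root_of_unity[OF assms(2)] by (simp add: norm_power[symmetric])
qed (use assms in auto)

lemma norm_dchar_le:
  assumes "M > 0"
  shows "norm (\<chi> a) \<le> 1"
  using norm_dchar[OF assms, of a] dchar_eq_0_iff[of a] by (cases "coprime a M") auto

lemma dchar_mult_cnj:
  assumes "M > 0" "coprime a M"
  shows "cnj (\<chi> a) * \<chi> a = 1"
  using norm_dchar[OF assms] complex_norm_square[of "\<chi> a"] by (simp add: mult.commute)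

lemma cnj_dchar_in_dchars: "(\<lambda>a. cnj (\<chi> a)) \<in> dchars M"
  using \<chi> unfolding dchars_def by simp

end

lemma mult_dchar_in_dchars:
  "\<chi> \<in> dchars M \<Longrightarrow> \<psi> \<in> dchars M \<Longrightarrow> (\<lambda>a. \<chi> a * \<psi> a) \<in> dchars M"
  unfolding dchars_def by simp

lemma finite_dchars:
  assumes "M > 0"
  shows "finite (dchars M)"
proof -
  let ?R = "insert 0 {z :: complex. z ^ totient M = 1}"
  have "dchars M \<subseteq> (\<lambda>f a. f (a mod M)) ` PiE {..<M} (\<lambda>_. ?R)"
  proof
    fix \<chi> assume \<chi>: "\<chi> \<in> dchars M"
    have "restrict \<chi> {..<M} \<in> PiE {..<M} (\<lambda>_. ?R)"
      using dchar_root_of_unity[OF \<chi>] dchar_eq_0_iff[OF \<chi>] by auto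
    moreover have "\<chi> = (\<lambda>a. restrict \<chi> {..<M} (a mod M))"
      using assms dchar_mod[OF \<chi>] by auto
    ultimately show "\<chi> \<in> (\<lambda>f a. f (a mod M)) ` PiE {..<M} (\<lambda>_. ?R)" by blast
  qed
  moreover have "finite ?R"
    using assms by (simp add: finite_roots_unity Suc_le_eq)
  ultimately show ?thesis
    by (meson finite_PiE finite_imageI finite_lessThan finite_subset)
qed

section \<open>Existence of enough characters to separate residues\<close>

lemma sum_powers_roots_unity:
  fixes e i :: nat
  assumes "e > 0" "i < e"
  shows "(\<Sum>u | u ^ e = 1. u ^ i) = (if i = 0 then of_nat e else (0::complex))"
proof (cases "i = 0")
  case True
  then show ?thesis using assms card_roots_unity_eq[of e] by (simp add: algebra_simps)
next
  case False
  let ?w = "\<lambda>k. cis (2 * pi * real k / real e)"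
  note bij = bij_betw_roots_unity[OF assms(1)]
  have "(\<Sum>u | u ^ e = 1. u ^ i) = (\<Sum>k<e. ?w k ^ i)"
    by (rule sum.reindex_bij_betw[OF bij, symmetric])
  also have "\<dots> = (\<Sum>k<e. ?w i ^ k)"
    by (intro sum.cong refl) (simp add: Complex.DeMoivre mult_ac)
  also have "\<dots> = 0"
  proof -
    have "?w i \<noteq> ?w 0"
      using bij assms False unfolding bij_betw_def inj_on_def by blast
    moreover have "?w i ^ e = 1"
      using bij_betw_apply[OF bij, of i] assms by simp
    ultimately show ?thesis by (simp add: geometric_sum)
  qed
  finally show ?thesis using False by simp
qed

text \<open>
  The translations \<open>F \<mapsto> (\<lambda>n. F (x * n))\<close> by units commute and have finite order, so averaging
  over the powers of one of them against the roots of unity splits \<open>F\<close> into eigenfunctions. A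
  simultaneous eigenfunction of all translations is a multiple of a character.
\<close>
lemma simultaneous_eigenfunction:
  fixes M a :: nat
  assumes M: "M > 0" and a: "\<not> [a = 1] (mod M)"
    and A: "finite A" "\<And>x. x \<in> A \<Longrightarrow> coprime x M"
  shows "\<exists>F :: nat \<Rightarrow> complex. (\<forall>n. F (n mod M) = F n) \<and> (\<forall>n. \<not> coprime n M \<longrightarrow> F n = 0)
           \<and> (\<forall>x\<in>A. \<exists>w. \<forall>n. F (x * n) = w * F n) \<and> (\<exists>n. F (a * n) \<noteq> F n)"
  using A
proof (induction A rule: finite_induct)
  case empty
  have "coprime n M" if "[n = 1] (mod M)" for n
    using that by (metis cong_imp_coprime cong_sym coprime_1_left)
  \<comment> \<open>The indicator of the class of 1 is moved by \<open>a\<close>: it is 1 at 1 and 0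
    at \<open>a\<close>.\<close>
  then show ?case using a
    by (intro exI[of _ "\<lambda>n. if [n = 1] (mod M) then 1 else 0"]) (auto intro!: exI[of _ 1] simp: cong_def)
next
  case (insert x A)
  from insert.IH[OF insert.prems[OF insertI2]] obtain F :: "nat \<Rightarrow> complex" where
    F': "(\<forall>n. F (n mod M) = F n) \<and> (\<forall>n. \<not> coprime n M \<longrightarrow> F n = 0)
          \<and> (\<forall>x\<in>A. \<exists>w. \<forall>n. F (x * n) = w * F n) \<and> (\<exists>n. F (a * n) \<noteq> F n)"
    ..
  have F: "\<And>n. F (n mod M) = F n" "\<And>n. \<not> coprime n M \<Longrightarrow> F n = 0"
       "\<And>y. y \<in> A \<Longrightarrow> \<exists>w. \<forall>n. F (y * n) = w * F n" "\<exists>n. F (a * n) \<noteq> F n"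
    using F' by blast+
  define e where "e = totient M"
  have e: "e > 0" using M by (simp add: e_def)
  have Fcong: "F m = F n" if "[m = n] (mod M)" for m n
    using that F(1) by (metis cong_def)
  \<comment> \<open>A discrete Fourier transform along the powers of \<open>x\<close>. Summed over
    all \<open>u\<close> it returns \<open>e * F\<close> (see \<open>sumP\<close>), so not every
    \<open>P u\<close> can be invariant under \<open>a\<close>.\<close>
  define P where "P u n = (\<Sum>i<e. u ^ i * F (x ^ i * n))" for u n
  have sumP: "(\<Sum>u | u ^ e = 1. P u n) = of_nat e * F n" for n
  proof -
    have "(\<Sum>u | u ^ e = 1. P u n) = (\<Sum>i<e. (\<Sum>u | u ^ e = 1. u ^ i) * F (x ^ i * n))"
      unfolding P_def by (subst sum.swap) (simp add: sum_distrib_right)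
    also have "\<dots> = (\<Sum>i<e. if i = 0 then of_nat e * F n else 0)"
      using e by (intro sum.cong) (auto simp: sum_powers_roots_unity)
    finally show ?thesis using e by simp
  qed
  have "\<exists>u. u ^ e = 1 \<and> (\<exists>n. P u (a * n) \<noteq> P u n)"
  proof (rule ccontr)
    assume "\<not> ?thesis"
    then have "(\<Sum>u | u ^ e = 1. P u (a * n)) = (\<Sum>u | u ^ e = 1. P u n)" for n
      by (intro sum.cong) auto
    then have "F (a * n) = F n" for n unfolding sumP using e by simp
    then show False using F(4) by simp
  qed
  then obtain u where u: "u ^ e = 1" "\<exists>n. P u (a * n) \<noteq> P u n" by blast
  have u0: "u \<noteq> 0" using u e by (auto simp: power_0_left)
  \<comment> \<open>Multiplying by \<open>u\<close> shifts the summation index by one; the ends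
    match because \<open>u ^ e = 1\<close> and \<open>x ^ e\<close> is 1 modulo
    \<open>M\<close>.\<close>
  have eig: "P u (x * n) = inverse u * P u n" for n
  proof -
    have "u * P u (x * n) = (\<Sum>i<e. u ^ Suc i * F (x ^ Suc i * n))"
      unfolding P_def by (simp add: sum_distrib_left mult_ac)
    also have "\<dots> = P u n + (u ^ e * F (x ^ e * n) - F n)"
      unfolding P_def
      using sum.lessThan_Suc_shift[of "\<lambda>i. u ^ i * F (x ^ i * n)" e] by (simp add: algebra_simps)
    also have "F (x ^ e * n) = F (1 * n)"
      using insert.prems euler_theorem[of x M] unfolding e_def
      by (intro Fcong cong_scalar_right) auto
    finally show ?thesis using u u0 by (simp add: field_simps)
  qed
  show ?case
  proof (intro exI[of _ "P u"] conjI allI ballI impI)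
    show "P u (n mod M) = P u n" for n
      unfolding P_def by (intro sum.cong arg_cong2[of _ _ _ _ "(*)"] refl Fcong) (simp add: cong_def mod_mult_right_eq)
    show "P u n = 0" if "\<not> coprime n M" for n
      unfolding P_def using that F(2) by (intro sum.neutral) auto
    show "\<exists>w. \<forall>n. P u (y * n) = w * P u n" if y: "y \<in> insert x A" for y
    proof (cases "y = x")
      case False
      then obtain w where w: "\<And>n. F (y * n) = w * F n" using y F(3)[of y] by blast
      have "F (x ^ i * (y * n)) = w * F (x ^ i * n)" for i n
        using w[of "x ^ i * n"] by (simp add: mult_ac)
      then have "P u (y * n) = w * P u n" for n
        unfolding P_def by (simp add: sum_distrib_left mult_ac)
      then show ?thesis by blast
    qed (use eig in blast)
    show "\<exists>n. P u (a * n) \<noteq> P u n" by fact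
  qed
qed

text \<open>With all units as translations, \<open>F (x * n) = w x * F n\<close> gives
  \<open>F x = w x * F 1\<close>. So \<open>F 1\<close> is nonzero, and \<open>F\<close> divided by
  \<open>F 1\<close> takes the eigenvalues as values and is multiplicative. At \<open>a\<close> it
  is not 1 because \<open>F (a * b) \<noteq> F b\<close> for some \<open>b\<close>.\<close>

lemma dchars_separate:
  assumes M: "M > 0" and a: "\<not> [a = 1] (mod M)" "coprime a M"
  obtains \<chi> where "\<chi> \<in> dchars M" "\<chi> a \<noteq> 1"
proof -
  have "finite {x. x < M \<and> coprime x M}" "\<And>x. x \<in> {x. x < M \<and> coprime x M} \<Longrightarrow> coprime x M"
    by simp_all
  then have "\<exists>F :: nat \<Rightarrow> complex. (\<forall>n. F (n mod M) = F n) \<and> (\<forall>n. \<not> coprime n M \<longrightarrow> F n = 0)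
           \<and> (\<forall>x\<in>{x. x < M \<and> coprime x M}. \<exists>w. \<forall>n. F (x * n) = w * F n) \<and> (\<exists>n. F (a * n) \<noteq> F n)"
    by (rule simultaneous_eigenfunction[OF M a(1)])
  then obtain F :: "nat \<Rightarrow> complex" where
    F': "(\<forall>n. F (n mod M) = F n) \<and> (\<forall>n. \<not> coprime n M \<longrightarrow> F n = 0)
           \<and> (\<forall>x\<in>{x. x < M \<and> coprime x M}. \<exists>w. \<forall>n. F (x * n) = w * F n) \<and> (\<exists>n. F (a * n) \<noteq> F n)"
    ..
  note F = F'[THEN conjunct1, rule_format] F'[THEN conjunct2, THEN conjunct1, rule_format]
    F'[THEN conjunct2, THEN conjunct2, THEN conjunct1, rule_format, OF CollectI, OF conjI]
    F'[THEN conjunct2, THEN conjunct2, THEN conjunct2]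
  have "\<exists>w. \<forall>n. F (x * n) = w * F n" if "coprime x M" for x
  proof -
    have "coprime (x mod M) M" using that M by simp
    then obtain w where w: "\<And>n. F (x mod M * n) = w * F n" using F(3)[of "x mod M"] M by auto
    have "F (x * n) = w * F n" for n
      using F(1)[of "x * n"] F(1)[of "x mod M * n"] w[of n] by (simp add: mod_mult_left_eq)
    then show ?thesis by blast
  qed
  then obtain w where w: "\<And>x n. coprime x M \<Longrightarrow> F (x * n) = w x * F n" by metis
  obtain b where b: "F (a * b) \<noteq> F b" using F(4) by blast
  have F1: "F 1 \<noteq> 0"
  proof
    assume 0: "F 1 = 0"
    have "F n = 0" for n
      using w[of n 1] F(2)[of n] 0 by (cases "coprime n M") auto
    then show False using b by simp
  qed
  define \<chi> where "\<chi> n = F n / F 1" for n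
  have eq: "\<chi> x = w x" if "coprime x M" for x
    using w[OF that, of 1] F1 by (simp add: \<chi>_def)
  show ?thesis
  proof
    show "\<chi> \<in> dchars M"
      unfolding dchars_def
    proof (intro CollectI conjI allI)
      show "\<chi> (x * y) = \<chi> x * \<chi> y" for x y
      proof (cases "coprime x M")
        case True
        then show ?thesis using eq[OF True] w[OF True, of y] by (simp add: \<chi>_def)
      qed (use F(2) in \<open>simp add: \<chi>_def\<close>)
      show "\<chi> (x mod M) = \<chi> x" for x by (simp add: \<chi>_def F)
      show "\<chi> x \<noteq> 0 \<longleftrightarrow> coprime x M" for x
      proof
        assume c: "coprime x M"
        then obtain y where "[x * y = 1] (mod M)" using cong_solve_coprime_nat[OF c] by auto
        then have "F (x * y) = F 1" using F(1) by (metis cong_def)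
        then show "\<chi> x \<noteq> 0" using w[OF c, of y] eq[OF c] F1 by auto
      qed (use F(2) in \<open>auto simp: \<chi>_def\<close>)
    qed
    show "\<chi> a \<noteq> 1" using eq[OF a(2)] w[OF a(2), of b] b by auto
  qed
qed

text \<open>Multiplication by a character \<psi> with \<open>\<psi> a \<noteq> 1\<close> permutes
  the characters, its inverse being multiplication by the conjugate, and scales the sum by
  \<open>\<psi> a\<close>.\<close>

lemma sum_dchars_eq_0:
  assumes M: "M > 0" and a: "\<not> [a = 1] (mod M)"
  shows "(\<Sum>\<chi>\<in>dchars M. \<chi> a) = 0"
proof (cases "coprime a M")
  case True
  obtain \<psi> where \<psi>: "\<psi> \<in> dchars M" "\<psi> a \<noteq> 1" using dchars_separate[OF M a True] .
  let ?f = "\<lambda>\<psi> \<chi> n. \<psi> n * \<chi> n" and ?c = "\<lambda>n. cnj (\<psi> n)"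
  have inv: "?f \<psi> (?f ?c \<chi>) = \<chi>" "?f ?c (?f \<psi> \<chi>) = \<chi>" if "\<chi> \<in> dchars M" for \<chi>
  proof -
    have "\<psi> n * (cnj (\<psi> n) * \<chi> n) = \<chi> n" for n
      using dchar_mult_cnj[OF \<psi>(1) M, of n] dchar_eq_0_iff[OF that, of n]
      by (cases "coprime n M") (auto simp: mult_ac)
    then show "?f \<psi> (?f ?c \<chi>) = \<chi>" "?f ?c (?f \<psi> \<chi>) = \<chi>" by (auto simp: mult_ac)
  qed
  have "bij_betw (?f \<psi>) (dchars M) (dchars M)"
    by (rule bij_betw_byWitness[of _ "?f ?c"])
       (auto simp: inv intro!: mult_dchar_in_dchars \<psi> cnj_dchar_in_dchars)
  from sum.reindex_bij_betw[OF this, of "\<lambda>\<chi>. \<chi> a"]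
  have "\<psi> a * (\<Sum>\<chi>\<in>dchars M. \<chi> a) = (\<Sum>\<chi>\<in>dchars M. \<chi> a)"
    by (simp add: sum_distrib_left[symmetric])
  then show ?thesis using \<psi>(2) by simp
qed (auto intro!: sum.neutral simp: dchar_eq_0_iff)

text \<open>The conjugate of \<open>\<chi> a\<close> is the value of \<chi> at an inverse
  \<open>b\<close> of \<open>a\<close>, which reduces the claim to \<open>sum_dchars_eq_0\<close> at
  \<open>b * n\<close>.\<close>

lemma dchars_orthogonality:
  assumes M: "M > 0" and a: "coprime a M"
  shows "(\<Sum>\<chi>\<in>dchars M. cnj (\<chi> a) * \<chi> n) = (if [n = a] (mod M) then of_nat (card (dchars M)) else 0)"
proof -
  obtain b where b: "[a * b = 1] (mod M)" using cong_solve_coprime_nat[OF a] by auto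
  have bb: "\<chi> b = cnj (\<chi> a)" if \<chi>: "\<chi> \<in> dchars M" for \<chi>
  proof -
    have "\<chi> a * \<chi> b = 1" using dchar_cong[OF \<chi> b] \<chi> by (simp add: dchar_mult)
    moreover have "cnj (\<chi> a) * \<chi> a = 1" using dchar_mult_cnj[OF \<chi> M a] .
    ultimately show ?thesis by (metis mult.commute mult.left_commute mult_1_right)
  qed
  have "(\<Sum>\<chi>\<in>dchars M. cnj (\<chi> a) * \<chi> n) = (\<Sum>\<chi>\<in>dchars M. \<chi> (b * n))"
    by (intro sum.cong) (simp_all add: bb dchar_mult)
  also have "\<dots> = (if [b * n = 1] (mod M) then of_nat (card (dchars M)) else 0)"
    using sum_dchars_eq_0[OF M] by (auto simp: dchar_cong)
  also have "[b * n = 1] (mod M) \<longleftrightarrow> [n = a] (mod M)"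
  proof
    assume "[b * n = 1] (mod M)"
    then have "[a * (b * n) = a * 1] (mod M)" by (rule cong_scalar_left)
    moreover have "[a * b * n = 1 * n] (mod M)" using b by (rule cong_scalar_right)
    ultimately show "[n = a] (mod M)" by (simp add: cong_def mult.assoc)
  next
    assume "[n = a] (mod M)"
    then have "[b * n = b * a] (mod M)" by (rule cong_scalar_left)
    then show "[b * n = 1] (mod M)" using b by (simp add: cong_def mult.commute)
  qed
  finally show ?thesis .
qed

text \<open>Multiplication by a unit \<open>b\<close> with \<open>\<chi> b \<noteq> 1\<close>
  permutes the residues and scales the sum by \<open>\<chi> b\<close>.\<close>

lemma sum_dchar_period:
  assumes M: "M > 0" and \<chi>: "\<chi> \<in> dchars M" "\<chi> \<noteq> principal_dchar M"
  shows "(\<Sum>a<M. \<chi> a) = 0"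
proof -
  obtain b where b: "coprime b M" "\<chi> b \<noteq> 1"
    using \<chi> dchar_eq_0_iff[OF \<chi>(1)] unfolding principal_dchar_def fun_eq_iff by metis
  have "inj_on (\<lambda>a. b * a mod M) {..<M}"
  proof (rule inj_onI)
    fix x y assume *: "x \<in> {..<M}" "y \<in> {..<M}" "b * x mod M = b * y mod M"
    then have "[x = y] (mod M)" using cong_mult_lcancel_nat[OF b(1), of x y] by (simp add: cong_def)
    then show "x = y" using * by (simp add: cong_less_modulus_unique_nat)
  qed
  moreover have "(\<lambda>a. b * a mod M) ` {..<M} \<subseteq> {..<M}" using M by auto
  ultimately have "bij_betw (\<lambda>a. b * a mod M) {..<M} {..<M}"
    by (simp add: bij_betw_def endo_inj_surj)
  from sum.reindex_bij_betw[OF this, of \<chi>] have "\<chi> b * (\<Sum>a<M. \<chi> a) = (\<Sum>a<M. \<chi> a)"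
    by (simp add: dchar_mod[OF \<chi>(1)] dchar_mult[OF \<chi>(1)] sum_distrib_left[symmetric])
  then show ?thesis using b(2) by simp
qed

text \<open>Complete periods cancel, and fewer than \<open>M\<close> terms of norm at most 1 remain.
  This bound feeds the Abel summations below.\<close>

lemma norm_sum_dchar_le:
  assumes M: "M > 0" and \<chi>: "\<chi> \<in> dchars M" "\<chi> \<noteq> principal_dchar M"
  shows "norm (\<Sum>a<n. \<chi> a) \<le> M"
proof -
  have "(\<Sum>a=q*M..<q*M+M. \<chi> a) = 0" for q
  proof -
    have "(\<Sum>a=q*M..<q*M+M. \<chi> a) = (\<Sum>a<M. \<chi> (a + q * M))"
      using sum.shift_bounds_nat_ivl[of \<chi> 0 "q * M" M] by (simp add: add.commute lessThan_atLeast0)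
    also have "\<dots> = (\<Sum>a<M. \<chi> a)"
      by (intro sum.cong dchar_cong[OF \<chi>(1)]) (auto simp: cong_def)
    finally show ?thesis using sum_dchar_period[OF assms] by simp
  qed
  then have 0: "(\<Sum>a<(n div M)*M. \<chi> a) = 0"
    unfolding sum.nat_group[symmetric] by (intro sum.neutral) auto
  have "(\<Sum>a<n. \<chi> a) = (\<Sum>a<(n div M)*M. \<chi> a) + (\<Sum>a=(n div M)*M..<n. \<chi> a)"
    by (simp add: lessThan_atLeast0 sum.atLeastLessThan_concat)
  also have "norm \<dots> \<le> (\<Sum>a=(n div M)*M..<n. 1)"
    unfolding 0 add_0_left using norm_dchar_le[OF \<chi>(1) M] by (intro sum_norm_le) simp
  also have "\<dots> = real (n - n div M * M)" by simp
  also have "\<dots> = real (n mod M)" by (simp only: minus_div_mult_eq_mod)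
  also have "\<dots> \<le> M" using M by (simp add: less_imp_le)
  finally show ?thesis .
qed

section \<open>The value at 1 of an L-series\<close>

lemma summation_by_parts:
  fixes c f :: "nat \<Rightarrow> 'a :: comm_ring"
  assumes "m \<le> n"
  defines "S \<equiv> \<lambda>n. \<Sum>k<n. c k"
  shows "(\<Sum>k=m..<n. c k * f k) = S n * f n - S m * f m + (\<Sum>k=m..<n. S (Suc k) * (f k - f (Suc k)))"
  using assms(1)
proof (induction n rule: dec_induct)
  case (step n)
  then show ?case by (simp add: S_def algebra_simps)
qed simp

text \<open>After summation by parts the differences of \<open>f\<close> telescope, so the three
  contributions \<open>B * f n\<close>, \<open>B * f m\<close> and \<open>B * (f m - f n)\<close>
  add up to \<open>2 * B * f m\<close>.\<close>

lemma norm_sum_antimono_le: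
  fixes c :: "nat \<Rightarrow> complex" and f :: "nat \<Rightarrow> real"
  assumes B: "\<And>n. norm (\<Sum>k<n. c k) \<le> B"
    and f: "\<And>k. k \<ge> m \<Longrightarrow> f (Suc k) \<le> f k" "\<And>k. k \<ge> m \<Longrightarrow> f k \<ge> 0"
    and mn: "m \<le> n"
  shows "norm (\<Sum>k=m..<n. c k * of_real (f k)) \<le> 2 * B * f m"
proof -
  let ?S = "\<lambda>n. \<Sum>k<n. c k"
  have "norm (\<Sum>k=m..<n. c k * of_real (f k))
      = norm (?S n * of_real (f n) - ?S m * of_real (f m)
          + (\<Sum>k=m..<n. ?S (Suc k) * of_real (f k - f (Suc k))))"
    by (subst summation_by_parts[OF mn]) simp
  also have "\<dots> \<le> norm (?S n) * f n + norm (?S m) * f m + (\<Sum>k=m..<n. norm (?S (Suc k)) * (f k - f (Suc k)))"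
  proof (intro norm_triangle_le add_mono norm_triangle_le_diff sum_norm_le)
    show "norm (?S n * of_real (f n)) \<le> norm (?S n) * f n" "norm (?S m * of_real (f m)) \<le> norm (?S m) * f m"
      using f(2) mn by (simp_all add: norm_mult)
    show "norm (?S (Suc k) * of_real (f k - f (Suc k))) \<le> norm (?S (Suc k)) * (f k - f (Suc k))"
      if "k \<in> {m..<n}" for k
      using f(1)[of k] that by (simp add: norm_mult flip: of_real_diff)
  qed
  also have "\<dots> \<le> B * f n + B * f m + (\<Sum>k=m..<n. B * (f k - f (Suc k)))"
    using f mn by (intro add_mono sum_mono mult_right_mono B) auto
  also have "(\<Sum>k=m..<n. B * (f k - f (Suc k))) = B * (f m - f n)"
    unfolding sum_distrib_left[symmetric] using sum_Suc_diff'[OF mn, of "\<lambda>k. - f k"] by simp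
  finally show ?thesis by (simp add: algebra_simps)
qed

text \<open>Monotonicity is asked for only from \<open>m\<close> on, so that the result covers
  \<open>ln k / k\<close>, which decreases only for \<open>k \<ge> 3\<close>.\<close>

lemma antimono_series:
  fixes c :: "nat \<Rightarrow> complex" and f :: "nat \<Rightarrow> real"
  assumes B: "\<And>n. norm (\<Sum>k<n. c k) \<le> B"
    and f: "\<And>k. k \<ge> m \<Longrightarrow> f (Suc k) \<le> f k" "f \<longlonglongrightarrow> 0"
    and n: "n \<ge> m"
  shows "norm ((\<Sum>k. c k * of_real (f k)) - (\<Sum>k<n. c k * of_real (f k))) \<le> 2 * B * f n"
proof -
  have anti: "f b \<le> f a" if "m \<le> a" "a \<le> b" for a b
    using that(2,1) by (induction b rule: dec_induct) (auto intro: order.trans f(1))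
  have f0: "f k \<ge> 0" if "k \<ge> m" for k
    using f(2) that by (intro LIMSEQ_le_const2) (auto intro!: exI[of _ k] anti)
  have bound: "norm (\<Sum>k=a..<b. c k * of_real (f k)) \<le> 2 * B * f a" if "a \<ge> m" for a b
  proof (cases "a \<le> b")
    case True
    then show ?thesis using that by (intro norm_sum_antimono_le B f f0) auto
  next
    case False
    have "0 \<le> B" using B[of 0] by simp
    then show ?thesis using False f0[OF that] by simp
  qed
  have "summable (\<lambda>k. c k * of_real (f k))"
    unfolding summable_Cauchy
  proof (intro allI impI)
    fix e :: real assume e: "e > 0"
    have "(\<lambda>k. 2 * B * f k) \<longlonglongrightarrow> 2 * B * 0" by (intro tendsto_intros f)
    then have "\<forall>\<^sub>F k in sequentially. 2 * B * f k < e" using e by (intro order_tendstoD(2)) auto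
    then obtain N where N: "\<And>k. k \<ge> N \<Longrightarrow> 2 * B * f k < e" by (auto simp: eventually_sequentially)
    show "\<exists>N. \<forall>a\<ge>N. \<forall>b. norm (\<Sum>k=a..<b. c k * of_real (f k)) < e"
      by (intro exI[of _ "max m N"] allI impI order.strict_trans1[OF bound] N) auto
  qed
  then have "(\<lambda>b. \<Sum>k<b. c k * of_real (f k)) \<longlonglongrightarrow> (\<Sum>k. c k * of_real (f k))"
    by (rule summable_LIMSEQ)
  then have "(\<lambda>b. (\<Sum>k<b. c k * of_real (f k)) - (\<Sum>k<n. c k * of_real (f k)))
      \<longlonglongrightarrow> (\<Sum>k. c k * of_real (f k)) - (\<Sum>k<n. c k * of_real (f k))"
    by (intro tendsto_intros)
  note lim = tendsto_norm[OF this]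
  have "\<forall>\<^sub>F b in sequentially. norm ((\<Sum>k<b. c k * of_real (f k)) - (\<Sum>k<n. c k * of_real (f k))) \<le> 2 * B * f n"
    using eventually_ge_at_top[of n]
  proof eventually_elim
    case (elim b)
    then show ?case using bound[OF n, of b]
      by (simp add: lessThan_atLeast0 sum_diff_nat_ivl)
  qed
  from tendsto_upperbound[OF lim this] show ?thesis by simp
qed

lemma sum_1_to_eq_lessThan:
  fixes f :: "nat \<Rightarrow> 'a :: comm_monoid_add"
  shows "f 0 = 0 \<Longrightarrow> (\<Sum>k=1..N. f k) = (\<Sum>k<Suc N. f k)"
  by (rule sum.mono_neutral_left) (auto simp: not_le)

lemma sum_inverse_sqrt_le: "(\<Sum>d=1..N. 1 / sqrt (real d)) \<le> 2 * sqrt (real N)"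
proof (induction N)
  case (Suc N)
  have "1 / sqrt (real (Suc N)) \<le> 2 * (sqrt (real (Suc N)) - sqrt (real N))"
  proof -
    have "(sqrt (real (Suc N)) - sqrt (real N)) * (sqrt (real (Suc N)) + sqrt (real N)) = 1"
      by (simp add: algebra_simps)
    moreover have "sqrt (real N) \<le> sqrt (real (Suc N))" by simp
    then have "(sqrt (real (Suc N)) - sqrt (real N)) * (sqrt (real (Suc N)) + sqrt (real N))
        \<le> (sqrt (real (Suc N)) - sqrt (real N)) * (2 * sqrt (real (Suc N)))"
      by (intro mult_left_mono) auto
    ultimately have "1 \<le> (2 * (sqrt (real (Suc N)) - sqrt (real N))) * sqrt (real (Suc N))"
      by (simp only: mult.assoc mult.left_commute)
    then show ?thesis by (subst pos_divide_le_eq) auto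
  qed
  then show ?case using Suc.IH by simp
qed simp

lemma ln_le_2_sqrt:
  fixes x :: real
  assumes "x > 0"
  shows "ln x \<le> 2 * sqrt x"
proof -
  have "ln x = 2 * ln (sqrt x)" using assms by (simp add: ln_sqrt)
  also have "ln (sqrt x) \<le> sqrt x" using assms ln_le_minus_one[of "sqrt x"] by simp
  finally show ?thesis by simp
qed

lemma nat_div_plus_1_ge: "d > 0 \<Longrightarrow> real N / real d \<le> real (N div d) + 1"
  using dividend_less_div_times[of d N]
  by (simp add: pos_divide_le_eq field_simps flip: of_nat_mult of_nat_add of_nat_Suc)

context
  fixes M :: nat and \<chi> :: "nat \<Rightarrow> complex"
  assumes M: "M > 0" and \<chi>: "\<chi> \<in> dchars M" "\<chi> \<noteq> principal_dchar M"
begin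

text \<open>The value \<open>L(1, \<chi>)\<close>; the term at \<open>k = 0\<close> is 0 because
  \<open>1 / 0 = 0\<close>.\<close>

definition dirichlet_L1 :: complex where
  "dirichlet_L1 = (\<Sum>k. \<chi> k * of_real (1 / real k))"

lemma dirichlet_L1_partial_sum:
  "norm ((\<Sum>k=1..N. \<chi> k * of_real (1 / real k)) - dirichlet_L1) \<le> 2 * M / (N + 1)"
proof -
  have "(\<lambda>k. 1 / real k) \<longlonglongrightarrow> 0" by (rule lim_1_over_n)
  then have "norm (dirichlet_L1 - (\<Sum>k<Suc N. \<chi> k * of_real (1 / real k))) \<le> 2 * real M * (1 / real (Suc N))"
    unfolding dirichlet_L1_def
    by (intro antimono_series[where m = 1] norm_sum_dchar_le[OF M \<chi>]) (auto simp: frac_le)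
  then show ?thesis by (subst sum_1_to_eq_lessThan) (simp_all add: norm_minus_commute add.commute)
qed

text \<open>The limit \<open>L'\<close> is minus the derivative of the L-series at 1. Abel summation
  gives an error of order \<open>ln N / N\<close>; weakening it to \<open>1 / sqrt N\<close> lets
  \<open>sum_inverse_sqrt_le\<close> control the later sums over \<open>d\<close>.\<close>

lemma dchar_ln_partial_sum:
  obtains C L' where "C \<ge> 0"
    "\<And>N. norm ((\<Sum>k=1..N. \<chi> k * of_real (ln (real k) / real k)) - L') \<le> C / sqrt (N + 1)"
proof
  define L' where "L' = (\<Sum>k. \<chi> k * of_real (ln (real k) / real k))"
  \<comment> \<open>The term \<open>2 * norm L'\<close> serves \<open>N < 2\<close>: there the
    partial sum is 0, so the error is \<open>norm L'\<close>, and
    \<open>sqrt (N + 1) \<le> 2\<close>.\<close>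
  define C where "C = 4 * M + 2 * norm L'"
  show "C \<ge> 0" by (simp add: C_def)
  show "norm ((\<Sum>k=1..N. \<chi> k * of_real (ln (real k) / real k)) - L') \<le> C / sqrt (N + 1)" for N
  proof (cases "N < 2")
    case True
    have "sqrt (real (N + 1)) \<le> sqrt 4" using True by (intro real_sqrt_le_mono) simp
    then have "norm L' * sqrt (N + 1) \<le> C" unfolding C_def
      using mult_left_mono[of "sqrt (real (N + 1))" 2 "norm L'"] by simp
    moreover have "N = 0 \<or> N = 1" using True by auto
    ultimately show ?thesis by (subst pos_le_divide_eq) auto
  next
    case False
    have lim: "(\<lambda>k. ln (real k) / real k) \<longlonglongrightarrow> 0"
      using filterlim_compose[OF ln_x_over_x_tendsto_0 filterlim_real_sequentially] .
    have "norm (L' - (\<Sum>k<Suc N. \<chi> k * of_real (ln (real k) / real k))) \<le> 2 * real M * (ln (real (Suc N)) / real (Suc N))"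
      unfolding L'_def
    proof (rule antimono_series[where m = 3])
      show "ln (real (Suc k)) / real (Suc k) \<le> ln (real k) / real k" if "3 \<le> k" for k
        using that exp_le by (intro ln_x_over_x_mono) auto
    qed (use False lim norm_sum_dchar_le[OF M \<chi>] in auto)
    also have "\<dots> \<le> 2 * real M * (2 * sqrt (Suc N) / real (Suc N))"
      using ln_le_2_sqrt[of "real (Suc N)"] by (intro mult_left_mono divide_right_mono) auto
    also have "\<dots> = 4 * M / sqrt (Suc N)"
      by (simp add: real_div_sqrt field_simps)
    also have "\<dots> \<le> C / sqrt (Suc N)" unfolding C_def by (intro divide_right_mono) auto
    finally show ?thesis by (subst sum_1_to_eq_lessThan) (simp_all add: norm_minus_commute add.commute)
  qed
qed

section \<open>Moebius and von Mangoldt sums twisted by a character\<close>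

lemma dchar_convolution:
  "(\<Sum>n=1..N. \<chi> n * of_real ((\<Sum>d | d dvd n. F d (n div d)) / real n))
     = (\<Sum>d=1..N. \<chi> d * of_real (1 / real d) * (\<Sum>k=1..N div d. \<chi> k * of_real (F d k / real k)))"
proof -
  let ?G = "\<lambda>d k. \<chi> d * of_real (1 / real d) * (\<chi> k * of_real (F d k / real k))"
  have "\<chi> n * of_real ((\<Sum>d | d dvd n. F d (n div d)) / real n) = (\<Sum>d | d dvd n. ?G d (n div d))"
    if "n \<in> {1..N}" for n
  proof -
    have "?G d (n div d) = \<chi> n * of_real (F d (n div d) / real n)" if "d dvd n" for d
      using that \<open>n \<in> _\<close> by (elim dvdE) (auto simp: dchar_mult[OF \<chi>(1)])
    then have "(\<Sum>d | d dvd n. ?G d (n div d)) = (\<Sum>d | d dvd n. \<chi> n * of_real (F d (n div d) / real n))"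
      by (intro sum.cong) auto
    then show ?thesis by (simp add: sum_distrib_left sum_divide_distrib)
  qed
  then show ?thesis
    using sum_up_to_divisors[of ?G N] by (simp add: sum_distrib_left)
qed

text \<open>With \<open>S\<close> the partial sums of the L-series, the terms
  \<open>\<chi> d * moebius d / d * S (N div d)\<close> add up to 1 by
  \<open>sum_moebius_divisors\<close>. Replacing each \<open>S (N div d)\<close> by
  \<open>dirichlet_L1\<close> costs at most \<open>2 * M / N\<close> per term, hence
  \<open>2 * M\<close> in total.\<close>

lemma sum_dchar_moebius_bounded:
  assumes "dirichlet_L1 \<noteq> 0"
  shows "norm (\<Sum>d=1..N. \<chi> d * of_real (moebius d / real d)) \<le> (1 + 2 * M) / norm dirichlet_L1"
proof (cases "N = 0")
  case False
  define S where "S n = (\<Sum>k=1..n. \<chi> k * of_real (1 / real k))" for n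
  define Mu where "Mu = (\<Sum>d=1..N. \<chi> d * of_real (moebius d / real d))"
  have "1 = (\<Sum>n=1..N. if n = 1 then 1 else 0 :: complex)" using False by simp
  also have "\<dots> = (\<Sum>n=1..N. \<chi> n * of_real ((\<Sum>d | d dvd n. moebius d) / real n))"
    using \<chi> by (intro sum.cong) (auto simp: sum_moebius_divisors)
  also have "\<dots> = (\<Sum>d=1..N. \<chi> d * of_real (moebius d / real d) * S (N div d))"
    unfolding dchar_convolution[of "\<lambda>d k. moebius d"] S_def
    by (simp add: sum_distrib_left mult_ac)
  finally have "1 - Mu * dirichlet_L1 = (\<Sum>d=1..N. \<chi> d * of_real (moebius d / real d) * (S (N div d) - dirichlet_L1))"
    unfolding Mu_def by (simp only: right_diff_distrib sum_subtractf sum_distrib_right)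
  also have "norm \<dots> \<le> (\<Sum>d=1..N. 2 * M / N)"
  proof (rule sum_norm_le)
    fix d assume d: "d \<in> {1..N}"
    have "norm (\<chi> d * of_real (moebius d / real d) * (S (N div d) - dirichlet_L1))
        \<le> (1 * (1 / d)) * (2 * M / real (N div d + 1))"
      unfolding norm_mult norm_of_real abs_divide using dirichlet_L1_partial_sum[of "N div d"] norm_dchar_le[OF \<chi>(1) M, of d] abs_moebius_le[of d]
      by (intro mult_mono) (auto simp: S_def divide_right_mono add.commute)
    also have "\<dots> \<le> (1 * (1 / d)) * (2 * M / (N / d))"
      using nat_div_plus_1_ge[of d N] d False by (intro mult_left_mono divide_left_mono) (auto simp: add.commute)
    finally show "norm (\<chi> d * of_real (moebius d / real d) * (S (N div d) - dirichlet_L1)) \<le> 2 * M / N"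
      using d by simp
  qed
  also have "\<dots> = 2 * M" using False by simp
  finally have "norm (Mu * dirichlet_L1) \<le> 1 + 2 * M"
    using norm_triangle_sub[of "Mu * dirichlet_L1" 1] by (simp add: norm_minus_commute)
  then show ?thesis using assms unfolding Mu_def by (simp add: norm_mult pos_le_divide_eq)
qed (use assms in simp)

text \<open>The same pattern with \<open>mangoldt\<close> as the convolution of
  \<open>moebius\<close> and \<open>ln\<close>: the main term is \<open>L'\<close> times the Moebius
  sum, which is bounded when \<open>dirichlet_L1 \<noteq> 0\<close>.\<close>

lemma sum_dchar_mangoldt_bounded:
  assumes "dirichlet_L1 \<noteq> 0"
  obtains C where "\<And>N. norm (\<Sum>n=1..N. \<chi> n * of_real (mangoldt n / real n)) \<le> C"
proof -
  obtain C L' where C: "C \<ge> 0"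
    "\<And>N. norm ((\<Sum>k=1..N. \<chi> k * of_real (ln (real k) / real k)) - L') \<le> C / sqrt (N + 1)"
    using dchar_ln_partial_sum by blast
  define T where "T n = (\<Sum>k=1..n. \<chi> k * of_real (ln (real k) / real k))" for n
  have "norm (\<Sum>n=1..N. \<chi> n * of_real (mangoldt n / real n)) \<le> (1 + 2 * M) / norm dirichlet_L1 * norm L' + 2 * C" for N
  proof (cases "N = 0")
    case False
    define Mu where "Mu = (\<Sum>d=1..N. \<chi> d * of_real (moebius d / real d))"
    define A where "A = (\<Sum>n=1..N. \<chi> n * of_real (mangoldt n / real n))"
    have "A = (\<Sum>n=1..N. \<chi> n * of_real ((\<Sum>d | d dvd n. moebius d * ln (real (n div d))) / real n))"
      unfolding A_def by (intro sum.cong) (auto simp del: of_real_divide simp: sum_moebius_ln_divisors)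
    also have "\<dots> = (\<Sum>d=1..N. \<chi> d * of_real (moebius d / real d) * T (N div d))"
      unfolding dchar_convolution[of "\<lambda>d k. moebius d * ln (real k)"] T_def
      by (simp add: sum_distrib_left mult_ac)
    finally have "A - Mu * L' = (\<Sum>d=1..N. \<chi> d * of_real (moebius d / real d) * (T (N div d) - L'))"
      unfolding Mu_def by (simp only: right_diff_distrib sum_subtractf sum_distrib_right)
    also have "norm \<dots> \<le> (\<Sum>d=1..N. C / sqrt N * (1 / sqrt d))"
    proof (rule sum_norm_le)
      fix d assume d: "d \<in> {1..N}"
      have "norm (\<chi> d * of_real (moebius d / real d) * (T (N div d) - L'))
          \<le> (1 * (1 / d)) * (C / sqrt (N div d + 1))"
        unfolding norm_mult norm_of_real abs_divide using C(2)[of "N div d"] norm_dchar_le[OF \<chi>(1) M, of d] abs_moebius_le[of d]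
        by (intro mult_mono) (auto simp: T_def divide_right_mono)
      also have "\<dots> \<le> (1 * (1 / d)) * (C / sqrt (N / d))"
        using nat_div_plus_1_ge[of d N] d False C(1)
        by (intro mult_left_mono divide_left_mono) (auto simp: add.commute)
      also have "\<dots> = C / sqrt N * (sqrt d / d)"
        by (simp add: real_sqrt_divide)
      also have "sqrt d / d = 1 / sqrt d"
        using d by (simp add: field_simps)
      finally show "norm (\<chi> d * of_real (moebius d / real d) * (T (N div d) - L')) \<le> C / sqrt N * (1 / sqrt d)" .
    qed
    also have "\<dots> \<le> C / sqrt N * (2 * sqrt N)"
      unfolding sum_distrib_left[symmetric] using C(1) by (intro mult_left_mono sum_inverse_sqrt_le) auto
    also have "\<dots> = 2 * C" using False by simp
    finally have "norm A \<le> norm (Mu * L') + 2 * C"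
      using norm_triangle_sub[of A "Mu * L'"] by simp
    also have "norm (Mu * L') \<le> (1 + 2 * M) / norm dirichlet_L1 * norm L'"
      unfolding norm_mult Mu_def using sum_dchar_moebius_bounded[OF assms] by (intro mult_right_mono) auto
    finally show ?thesis by (simp add: A_def)
  qed (use C in simp)
  then show ?thesis using that by blast
qed

text \<open>With \<open>L(1, \<chi>) = 0\<close> the partial sums \<open>S (N div d)\<close> are
  themselves of order \<open>d / N\<close>, so the weights \<open>moebius d * ln (N / d)\<close>
  give a bounded sum. Their divisor sum is \<open>mangoldt n\<close> plus an extra
  \<open>ln N\<close> at \<open>n = 1\<close>, whence the \<open>- ln N\<close>.\<close>

lemma sum_dchar_mangoldt_L1_0:
  assumes "dirichlet_L1 = 0" "N > 0"
  shows "norm ((\<Sum>n=1..N. \<chi> n * of_real (mangoldt n / real n)) + of_real (ln (real N))) \<le> 8 * M"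
proof -
  define S where "S n = (\<Sum>k=1..n. \<chi> k * of_real (1 / real k))" for n
  define A where "A = (\<Sum>n=1..N. \<chi> n * of_real (mangoldt n / real n))"
  have div: "(\<Sum>d | d dvd n. moebius d * ln (real N / real d)) = (if n = 1 then ln (real N) else 0) + mangoldt n"
    if "n \<in> {1..N}" for n
  proof -
    \<comment> \<open>Here \<open>ln (N / d)\<close> is split as
      \<open>ln (N / n) + ln (n / d)\<close>; Moebius summation kills the first part unless
      \<open>n = 1\<close>.\<close>
    have "(\<Sum>d | d dvd n. moebius d * ln (real N / real d))
        = (\<Sum>d | d dvd n. moebius d * ln (real N / real n) + moebius d * ln (real (n div d)))"
      using that by (intro sum.cong) (auto elim!: dvdE simp: ln_div ln_mult algebra_simps)
    also have "\<dots> = (if n = 1 then ln (real N) else 0) + mangoldt n"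
      using that by (simp add: sum.distrib sum_distrib_right[symmetric] sum_moebius_divisors sum_moebius_ln_divisors del: of_nat_div)
    finally show ?thesis .
  qed
  have "A + of_real (ln (real N)) = (\<Sum>n=1..N. \<chi> n * of_real (mangoldt n / real n) + (if n = 1 then of_real (ln (real N)) else 0))"
    unfolding A_def using assms by (simp add: sum.distrib)
  also have "\<dots> = (\<Sum>n=1..N. \<chi> n * of_real ((\<Sum>d | d dvd n. moebius d * ln (real N / real d)) / real n))"
    using \<chi> by (intro sum.cong) (auto simp: div)
  also have "\<dots> = (\<Sum>d=1..N. \<chi> d * of_real (moebius d * ln (real N / real d) / real d) * S (N div d))"
    unfolding dchar_convolution[of "\<lambda>d k. moebius d * ln (real N / real d)"] S_def
    by (simp add: sum_distrib_left sum_divide_distrib mult_ac)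
  also have "norm \<dots> \<le> (\<Sum>d=1..N. 4 * M / sqrt N * (1 / sqrt d))"
  proof (rule sum_norm_le)
    fix d assume d: "d \<in> {1..N}"
    have ln: "0 \<le> ln (real N / d)" "ln (real N / d) \<le> 2 * sqrt (N / d)"
      using d assms by (auto intro!: ln_le_2_sqrt)
    have "norm (\<chi> d * of_real (moebius d * ln (real N / real d) / real d) * S (N div d))
        \<le> (1 * ((1 * (2 * sqrt (N / d))) / d)) * (2 * M / (N div d + 1))"
      unfolding norm_mult norm_of_real abs_mult abs_divide
      using dirichlet_L1_partial_sum[of "N div d"] norm_dchar_le[OF \<chi>(1) M, of d] abs_moebius_le[of d] ln assms
      by (intro mult_mono divide_mono) (use d in \<open>auto simp: S_def add.commute\<close>)
    also have "\<dots> \<le> (1 * ((1 * (2 * sqrt (N / d))) / d)) * (2 * M / (N / d))"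
      using nat_div_plus_1_ge[of d N] d assms by (intro mult_left_mono divide_left_mono) (auto simp: add.commute)
    also have "\<dots> = 4 * M * (sqrt N / N) * (1 / sqrt d)"
      using d by (simp add: real_sqrt_divide mult_ac)
    also have "sqrt N / N = 1 / sqrt N"
      using assms by (simp add: field_simps)
    finally show "norm (\<chi> d * of_real (moebius d * ln (real N / real d) / real d) * S (N div d)) \<le> 4 * M / sqrt N * (1 / sqrt d)"
      by simp
  qed
  also have "\<dots> \<le> 4 * M / sqrt N * (2 * sqrt N)"
    unfolding sum_distrib_left[symmetric] by (intro mult_left_mono sum_inverse_sqrt_le) auto
  also have "\<dots> = 8 * M" using assms by simp
  finally show ?thesis by (simp add: A_def)
qed

end

section \<open>Mertens-type estimates and nonreal characters\<close>

lemma ln_fact_eq_sum: "ln (fact N :: real) = (\<Sum>n=1..N. ln (real n))"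
  by (induction N) (simp_all add: ln_mult)

text \<open>Chebyshev's identity: when \<open>ln (fact N)\<close> is written as a double sum over
  divisors, \<open>d\<close> occurs once for each of its \<open>N div d\<close> multiples up to
  \<open>N\<close>.\<close>

lemma sum_mangoldt_div: "(\<Sum>d=1..N. mangoldt d * real (N div d)) = ln (fact N :: real)"
proof -
  have "ln (fact N :: real) = (\<Sum>n=1..N. \<Sum>d | d dvd n. mangoldt d)"
    unfolding ln_fact_eq_sum
  proof (intro sum.cong refl)
    fix n assume "n \<in> {1..N}"
    then show "ln (real n) = (\<Sum>d | d dvd n. mangoldt d)"
      using mangoldt_sum[of n, where 'a = real] by simp
  qed
  also have "\<dots> = (\<Sum>d=1..N. \<Sum>k=1..N div d. mangoldt d)"
    by (rule sum_up_to_divisors)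
  finally show ?thesis by (simp add: mult.commute)
qed

text \<open>The nonreal case below requires a factor smaller than 2. Since
  \<open>N / d \<ge> 1\<close>, the quotient \<open>k * N div d\<close> is at least
  \<open>(k - 1) * N / d\<close>, and comparison with \<open>ln (fact (k * N))\<close> gives the
  factor \<open>k / (k - 1)\<close>; \<open>k = 3\<close> is the first choice that is below
  2.\<close>

lemma sum_mangoldt_upper:
  assumes "N > 0"
  shows "(\<Sum>d=1..N. mangoldt d / real d) \<le> 3 / 2 * ln (3 * real N)"
proof -
  have "2 * real N * (\<Sum>d=1..N. mangoldt d / real d) = (\<Sum>d=1..N. mangoldt d * (2 * real N / real d))"
    by (simp add: sum_distrib_left mult_ac)
  also have "\<dots> \<le> (\<Sum>d=1..N. mangoldt d * real (3 * N div d))"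
  proof (intro sum_mono mult_left_mono mangoldt_nonneg)
    fix d assume d: "d \<in> {1..N}"
    have "2 * real N / real d + 1 \<le> real (3 * N) / real d" using d by (simp add: field_simps)
    also have "\<dots> \<le> real (3 * N div d) + 1" using d by (intro nat_div_plus_1_ge) auto
    finally show "2 * real N / real d \<le> real (3 * N div d)" by simp
  qed
  also have "\<dots> \<le> (\<Sum>d=1..3*N. mangoldt d * real (3 * N div d))"
    by (intro sum_mono2) (auto simp: mangoldt_nonneg)
  also have "\<dots> = (\<Sum>n=1..3*N. ln (real n))"
    unfolding sum_mangoldt_div ln_fact_eq_sum ..
  also have "\<dots> \<le> (\<Sum>n=1..3*N. ln (3 * real N))"
    by (intro sum_mono) auto
  also have "\<dots> = 2 * real N * (3 / 2 * ln (3 * real N))" by simp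
  finally show ?thesis by (rule mult_left_le_imp_le) (use assms in simp)
qed

lemma ln_fact_lower: "real N * ln (real N) - real N \<le> ln (fact N :: real)"
proof (induction N)
  case (Suc N)
  show ?case
  proof (cases "N = 0")
    case False
    have "1 + 1 / real N = real (Suc N) / real N" using False by (simp add: field_simps)
    then have "real N * (ln (real (Suc N)) - ln (real N)) = real N * ln (1 + 1 / real N)"
      using False ln_div[of "real (Suc N)" "real N"] by simp
    also have "\<dots> \<le> real N * (1 / real N)"
      by (intro mult_left_mono ln_add_one_self_le_self) auto
    finally have "real N * (ln (real (Suc N)) - ln (real N)) \<le> 1" using False by simp
    moreover have "ln (fact (Suc N) :: real) = ln (real (Suc N)) + ln (fact N)"
      unfolding fact_Suc by (rule ln_mult_pos) auto
    moreover have "real (Suc N) * x = real N * x + x" for x by (simp add: algebra_simps)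
    ultimately show ?thesis using Suc.IH by (simp only: right_diff_distrib)
  qed simp
qed simp

lemma sum_mangoldt_lower:
  assumes "N > 0"
  shows "ln (real N) - 1 \<le> (\<Sum>d=1..N. mangoldt d / real d)"
proof -
  have "real N * (ln (real N) - 1) \<le> (\<Sum>d=1..N. mangoldt d * real (N div d))"
    using ln_fact_lower[of N] unfolding sum_mangoldt_div by (simp add: algebra_simps)
  also have "\<dots> \<le> (\<Sum>d=1..N. mangoldt d * (real N / real d))"
    by (intro sum_mono mult_left_mono mangoldt_nonneg of_nat_div_le_of_nat)
  also have "\<dots> = real N * (\<Sum>d=1..N. mangoldt d / real d)"
    by (simp add: sum_distrib_left mult_ac)
  finally show ?thesis using assms by simp
qed

text \<open>The subtracted \<open>2 / sqrt N\<close> makes the sum telescope: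
  \<open>1 / z ^ 3 \<le> 2 / y - 2 / z\<close> for the square roots \<open>y\<close>,
  \<open>z\<close> of consecutive integers.\<close>

lemma sum_inverse_sqrt_cubed_le:
  assumes "N > 0"
  shows "(\<Sum>d=2..N. 1 / (real d * sqrt (real d))) \<le> 2 - 2 / sqrt (real N)"
  using assms
proof (induction N rule: nat_induct_non_zero)
  case (Suc N)
  define y z where "y = sqrt (real N)" and "z = sqrt (real (Suc N))"
  have yz: "0 < y" "y \<le> z" "z * z = y * y + 1" using Suc.hyps by (simp_all add: y_def z_def)
  have "1 / (z * z * z) \<le> 2 / y - 2 / z"
  proof -
    have "(z - y) * (z + y) = 1" using yz by (simp add: algebra_simps)
    moreover have "(z - y) * (z + y) \<le> (z - y) * (2 * z)" using yz by (intro mult_left_mono) auto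
    ultimately have *: "1 \<le> 2 * (z - y) * z" by (simp only: mult.assoc mult.left_commute)
    have "1 / (z * z * z) \<le> 1 / (y * z * z)" using yz by (intro divide_left_mono mult_right_mono mult_pos_pos) auto
    also have "\<dots> \<le> 2 * (z - y) * z / (y * z * z)" using * yz by (intro divide_right_mono) auto
    also have "\<dots> = 2 / y - 2 / z" using yz(1,2) by (simp add: field_simps)
    finally show ?thesis .
  qed
  moreover have "1 / (real (Suc N) * sqrt (real (Suc N))) = 1 / (z * z * z)" by (simp add: z_def)
  ultimately have "1 / (real (Suc N) * sqrt (real (Suc N))) \<le> 2 / sqrt (real N) - 2 / sqrt (real (Suc N))"
    by (simp add: y_def z_def)
  then show ?case using Suc by simp
qed simp

lemma geometric_from_2_le:
  fixes x :: real
  assumes "0 \<le> x" "x \<le> 1 / 2"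
  shows "(\<Sum>k=2..N. x ^ k) \<le> 2 * x\<^sup>2"
proof -
  \<comment> \<open>Subtracting \<open>x ^ N\<close> strengthens the claim so that the induction
    step reduces to \<open>2 * x \<le> 1\<close>.\<close>
  have "(\<Sum>k=2..N. x ^ k) \<le> 2 * x\<^sup>2 - x ^ N" if "N \<ge> 2"
    using that
  proof (induction N rule: dec_induct)
    case (step N)
    have "2 * x * x ^ N \<le> 1 * x ^ N" using assms by (intro mult_right_mono) auto
    then show ?case using step by simp
  qed simp
  moreover have "0 \<le> x ^ N" using assms by simp
  ultimately show ?thesis by (cases "N \<ge> 2") auto
qed

text \<open>Only proper prime powers contribute. For each prime the geometric series and
  \<open>ln p \<le> 2 * sqrt p\<close> leave at most \<open>4 / (p * sqrt p)\<close>, and these sum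
  to at most \<open>4 * 2\<close>.\<close>

lemma sum_mangoldt_nonprime_le:
  "(\<Sum>n\<in>{n\<in>{1..N}. \<not> prime n}. mangoldt n / real n) \<le> 8"
proof (cases "N = 0")
  case False
  let ?P = "{p\<in>{2..N}. prime p}"
  have "(\<Sum>n\<in>{n\<in>{1..N}. \<not> prime n}. mangoldt n / real n)
      \<le> (\<Sum>n\<in>(\<lambda>(p, k). p ^ k) ` (?P \<times> {2..N}). mangoldt n / real n)"
  proof -
    have zero: "mangoldt n / real n = 0"
      if n: "n \<in> {n\<in>{1..N}. \<not> prime n} - (\<lambda>(p, k). p ^ k) ` (?P \<times> {2..N})" for n
    proof -
      have "\<not> primepow n"
      proof
        assume "primepow n"
        then obtain p k where pk: "prime p" "k > 0" "n = p ^ k" unfolding primepow_def by auto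
        have "k \<noteq> 1" using n pk by auto
        have "k < 2 ^ k" by simp
        also have "2 ^ k \<le> p ^ k" using pk prime_ge_2_nat by (intro power_mono) auto
        finally have "k \<le> N" using n pk by auto
        moreover have "p \<le> N" using n pk self_le_power[of p k] prime_gt_0_nat[of p] by auto
        ultimately have "n \<in> (\<lambda>(p, k). p ^ k) ` (?P \<times> {2..N})"
          using pk \<open>k \<noteq> 1\<close> prime_ge_2_nat[of p] by force
        then show False using n by blast
      qed
      then show ?thesis by (simp add: mangoldt_def)
    qed
    have "(\<Sum>n\<in>{n\<in>{1..N}. \<not> prime n}. mangoldt n / real n)
        = (\<Sum>n\<in>{n\<in>{1..N}. \<not> prime n} \<inter> (\<lambda>(p, k). p ^ k) ` (?P \<times> {2..N}). mangoldt n / real n)"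
      using zero by (intro sum.mono_neutral_right) auto
    also have "\<dots> \<le> (\<Sum>n\<in>(\<lambda>(p, k). p ^ k) ` (?P \<times> {2..N}). mangoldt n / real n)"
      by (intro sum_mono2) (auto simp: mangoldt_nonneg)
    finally show ?thesis .
  qed
  also have "\<dots> \<le> (\<Sum>x\<in>?P \<times> {2..N}. mangoldt (case x of (p, k) \<Rightarrow> p ^ k) / real (case x of (p, k) \<Rightarrow> p ^ k))"
    by (intro sum_image_le[where g = "\<lambda>n. mangoldt n / real n", unfolded o_def]) (auto simp: mangoldt_nonneg)
  also have "\<dots> = (\<Sum>p\<in>?P. \<Sum>k=2..N. mangoldt (p ^ k) / real (p ^ k))"
    by (simp only: sum.cartesian_product split_def)
  also have "\<dots> \<le> (\<Sum>p\<in>?P. 4 * (1 / (real p * sqrt (real p))))"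
  proof (rule sum_mono)
    fix p assume "p \<in> ?P"
    then have p: "prime p" "p \<ge> 2" by auto
    have "(\<Sum>k=2..N. mangoldt (p ^ k) / real (p ^ k)) = ln (real p) * (\<Sum>k=2..N. (1 / real p) ^ k)"
      unfolding sum_distrib_left using p by (intro sum.cong) (auto simp: power_one_over)
    also have "\<dots> \<le> (2 * sqrt (real p)) * (2 * (1 / real p)\<^sup>2)"
      using p by (intro mult_mono ln_le_2_sqrt geometric_from_2_le sum_nonneg) auto
    also have "\<dots> = 4 * (1 / (real p * sqrt (real p)))"
      using p by (simp add: field_simps power2_eq_square)
    finally show "(\<Sum>k=2..N. mangoldt (p ^ k) / real (p ^ k)) \<le> 4 * (1 / (real p * sqrt (real p)))" .
  qed
  also have "\<dots> \<le> (\<Sum>p=2..N. 4 * (1 / (real p * sqrt (real p))))"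
    by (intro sum_mono2) auto
  also have "\<dots> \<le> 4 * (2 - 2 / sqrt (real N))"
    unfolding sum_distrib_left[symmetric] using False by (intro mult_left_mono sum_inverse_sqrt_cubed_le) auto
  also have "\<dots> \<le> 8" by simp
  finally show ?thesis .
qed simp

text \<open>A truncation of the Dirichlet series of \<open>- L'(s, \<chi>) / L(s, \<chi>)\<close> at
  \<open>s = 1\<close>.\<close>

definition dchar_mangoldt_sum :: "(nat \<Rightarrow> complex) \<Rightarrow> nat \<Rightarrow> complex" where
  "dchar_mangoldt_sum \<chi> N = (\<Sum>n=1..N. \<chi> n * of_real (mangoldt n / real n))"

lemma dchar_mangoldt_sum_cnj:
  "dchar_mangoldt_sum (\<lambda>n. cnj (\<chi> n)) N = cnj (dchar_mangoldt_sum \<chi> N)"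
  by (simp add: dchar_mangoldt_sum_def del: of_real_divide of_real_mangoldt)

lemma dchar_mangoldt_sum_principal:
  "dchar_mangoldt_sum (principal_dchar M) N = of_real (\<Sum>n\<in>{n\<in>{1..N}. coprime n M}. mangoldt n / real n)"
  unfolding dchar_mangoldt_sum_def of_real_sum
  by (rule sum.mono_neutral_cong_right) (auto simp: principal_dchar_def)

lemma Re_dchar_mangoldt_sum_principal_upper:
  assumes "N > 0"
  shows "Re (dchar_mangoldt_sum (principal_dchar M) N) \<le> 3 / 2 * ln (3 * real N)"
proof -
  have "(\<Sum>n\<in>{n\<in>{1..N}. coprime n M}. mangoldt n / real n) \<le> (\<Sum>n=1..N. mangoldt n / real n)"
    by (intro sum_mono2) (auto simp: mangoldt_nonneg)
  then show ?thesis
    using sum_mangoldt_upper[OF assms] by (simp add: dchar_mangoldt_sum_principal del: of_real_sum)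
qed

text \<open>A nonzero term lost to coprimality with \<open>M\<close> belongs to a nonprime
  \<open>n\<close> or to one of the finitely many prime factors of \<open>M\<close>. In the
  constant, 9 is 8 from \<open>sum_mangoldt_nonprime_le\<close> plus 1 from
  \<open>sum_mangoldt_lower\<close>.\<close>

lemma Re_dchar_mangoldt_sum_principal_lower:
  assumes M: "M > 0"
  obtains C where "\<And>N. N > 0 \<Longrightarrow> ln (real N) - C \<le> Re (dchar_mangoldt_sum (principal_dchar M) N)"
proof
  fix N :: nat assume N: "N > 0"
  let ?f = "\<lambda>n. mangoldt n / real n :: real"
  have "(\<Sum>n\<in>{n\<in>{1..N}. \<not> coprime n M}. ?f n) \<le> (\<Sum>n\<in>{n\<in>{1..N}. \<not> prime n} \<union> prime_factors M. ?f n)"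
  proof (rule sum_mono2)
    show "{n \<in> {1..N}. \<not> coprime n M} \<subseteq> {n \<in> {1..N}. \<not> prime n} \<union> prime_factors M"
      using M by (auto simp: prime_factors_dvd dest: prime_imp_coprime)
  qed (auto simp: mangoldt_nonneg)
  also have "\<dots> \<le> (\<Sum>n\<in>{n\<in>{1..N}. \<not> prime n}. ?f n) + (\<Sum>n\<in>prime_factors M. ?f n)"
    by (subst sum_Un) (auto intro!: sum_nonneg simp: mangoldt_nonneg)
  also have "\<dots> \<le> 8 + (\<Sum>n\<in>prime_factors M. ?f n)"
    using sum_mangoldt_nonprime_le[of N] by simp
  finally have *: "(\<Sum>n\<in>{n\<in>{1..N}. \<not> coprime n M}. ?f n) \<le> 8 + (\<Sum>n\<in>prime_factors M. ?f n)" .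
  have "(\<Sum>n=1..N. ?f n) = (\<Sum>n\<in>{n\<in>{1..N}. coprime n M} \<union> {n\<in>{1..N}. \<not> coprime n M}. ?f n)"
    by (intro sum.cong) auto
  also have "\<dots> = (\<Sum>n\<in>{n\<in>{1..N}. coprime n M}. ?f n) + (\<Sum>n\<in>{n\<in>{1..N}. \<not> coprime n M}. ?f n)"
    by (intro sum.union_disjoint) auto
  finally show "ln (real N) - (9 + (\<Sum>n\<in>prime_factors M. ?f n)) \<le> Re (dchar_mangoldt_sum (principal_dchar M) N)"
    using * sum_mangoldt_lower[OF N] by (simp add: dchar_mangoldt_sum_principal del: of_real_sum)
qed

text \<open>A zero of the L-series at 1 only pushes the sum towards minus infinity, so this
  one-sided bound is available before nonvanishing is proved.\<close>

lemma Re_dchar_mangoldt_sum_upper: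
  assumes "M > 0" "\<chi> \<in> dchars M" "\<chi> \<noteq> principal_dchar M"
  obtains C where "\<And>N. N > 0 \<Longrightarrow> Re (dchar_mangoldt_sum \<chi> N) \<le> C"
proof (cases "dirichlet_L1 \<chi> = 0")
  case True
  have "Re (dchar_mangoldt_sum \<chi> N) \<le> 8 * M" if "N > 0" for N
    using sum_dchar_mangoldt_L1_0[OF assms True that] that complex_Re_le_cmod order_trans
      ln_ge_zero[of "real N"]
    unfolding dchar_mangoldt_sum_def[symmetric] by (smt (verit) Re_complex_of_real plus_complex.sel(1) of_nat_0_less_iff of_nat_1 of_nat_mono Suc_leI One_nat_def)
  then show ?thesis using that by blast
next
  case False
  obtain C where "\<And>N. norm (dchar_mangoldt_sum \<chi> N) \<le> C"
    using sum_dchar_mangoldt_bounded[OF assms False] unfolding dchar_mangoldt_sum_def by blast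
  then show ?thesis using that complex_Re_le_cmod order_trans by blast
qed

lemma sum_dchar_mangoldt_sums:
  assumes "M > 0" "coprime a M"
  shows "(\<Sum>\<chi>\<in>dchars M. cnj (\<chi> a) * dchar_mangoldt_sum \<chi> N)
       = of_real (card (dchars M) * (\<Sum>n\<in>{n\<in>{1..N}. [n = a] (mod M)}. mangoldt n / real n))"
proof -
  have "(\<Sum>\<chi>\<in>dchars M. cnj (\<chi> a) * dchar_mangoldt_sum \<chi> N)
      = (\<Sum>n=1..N. (\<Sum>\<chi>\<in>dchars M. cnj (\<chi> a) * \<chi> n) * of_real (mangoldt n / real n))"
    unfolding dchar_mangoldt_sum_def sum_distrib_left sum_distrib_right mult.assoc by (rule sum.swap)
  also have "\<dots> = (\<Sum>n\<in>{n\<in>{1..N}. [n = a] (mod M)}. of_nat (card (dchars M)) * of_real (mangoldt n / real n))"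
    by (rule sum.mono_neutral_cong_right) (auto simp: dchars_orthogonality[OF assms])
  finally show ?thesis by (simp add: sum_distrib_left)
qed

text \<open>At the class \<open>a = 1\<close> every coefficient \<open>cnj (\<psi> 1)\<close> is 1
  and the total is nonnegative. Under the assumed zero the upper bounds add up to
  \<open>K + 3 / 2 * ln (3 * N) + 2 * (8 * M - ln N)\<close>, which is negative for large
  \<open>N\<close>.\<close>

lemma dirichlet_L1_nonreal_nonzero:
  assumes M: "M > 0" and \<chi>: "\<chi> \<in> dchars M" "\<chi> \<noteq> principal_dchar M"
    and nonreal: "(\<lambda>n. cnj (\<chi> n)) \<noteq> \<chi>"
  shows "dirichlet_L1 \<chi> \<noteq> 0"
proof
  assume L0: "dirichlet_L1 \<chi> = 0"
  define \<chi>' where "\<chi>' = (\<lambda>n. cnj (\<chi> n))"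
  define \<chi>0 where "\<chi>0 = principal_dchar M"
  let ?A = dchar_mangoldt_sum
  have "\<forall>\<psi>\<in>dchars M - {\<chi>0}. \<exists>c. \<forall>N>0. Re (?A \<psi> N) \<le> c"
  proof
    fix \<psi> assume "\<psi> \<in> dchars M - {\<chi>0}"
    then have "\<psi> \<in> dchars M" "\<psi> \<noteq> principal_dchar M" by (auto simp: \<chi>0_def)
    then show "\<exists>c. \<forall>N>0. Re (?A \<psi> N) \<le> c"
      using Re_dchar_mangoldt_sum_upper[OF M] by blast
  qed
  from bchoice[OF this]
obtain C where "\<forall>\<psi>\<in>dchars M - {\<chi>0}. \<forall>N>0. Re (?A \<psi> N) \<le> C \<psi>" ..
  then have C: "Re (?A \<psi> N) \<le> C \<psi>" if "\<psi> \<in> dchars M - {\<chi>0}" "N > 0" for \<psi> N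
    using that by blast
  define K where "K = (\<Sum>\<psi>\<in>dchars M - {\<chi>0, \<chi>, \<chi>'}. C \<psi>)"
  have distinct: "\<chi>' \<noteq> \<chi>" "\<chi>' \<noteq> \<chi>0" "\<chi> \<noteq> \<chi>0"
  proof -
    show "\<chi>' \<noteq> \<chi>" unfolding \<chi>'_def by (rule nonreal)
    show "\<chi> \<noteq> \<chi>0" unfolding \<chi>0_def by (rule \<chi>(2))
    show "\<chi>' \<noteq> \<chi>0"
    proof
      assume "\<chi>' = \<chi>0"
      then have "cnj (\<chi> n) = principal_dchar M n" for n unfolding \<chi>'_def \<chi>0_def by (rule fun_cong)
      from this[THEN arg_cong[of _ _ cnj]] have "\<chi> n = principal_dchar M n" for n
        by (simp add: principal_dchar_def)
      then show False using \<chi>(2) by (simp add: fun_eq_iff)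
    qed
  qed
  have sub: "{\<chi>0, \<chi>, \<chi>'} \<subseteq> dchars M"
    using \<chi> M principal_dchar_in_dchars cnj_dchar_in_dchars[OF \<chi>(1)] by (simp add: \<chi>0_def \<chi>'_def)
  have bound: "ln (real N) / 2 \<le> 3 / 2 * ln 3 + 16 * M + K" if N: "N > 0" for N
  proof -
    have "0 \<le> Re (\<Sum>\<psi>\<in>dchars M. cnj (\<psi> 1) * ?A \<psi> N)"
      unfolding sum_dchar_mangoldt_sums[OF M coprime_1_left] by (auto intro!: mult_nonneg_nonneg sum_nonneg mangoldt_nonneg divide_nonneg_nonneg)
    also have "\<dots> = (\<Sum>\<psi>\<in>dchars M. Re (?A \<psi> N))"
      by simp
    also have "\<dots> = (\<Sum>\<psi>\<in>dchars M - {\<chi>0, \<chi>, \<chi>'}. Re (?A \<psi> N)) + (\<Sum>\<psi>\<in>{\<chi>0, \<chi>, \<chi>'}. Re (?A \<psi> N))"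
      by (rule sum.subset_diff[OF sub finite_dchars[OF M]])
    also have "(\<Sum>\<psi>\<in>{\<chi>0, \<chi>, \<chi>'}. Re (?A \<psi> N)) = Re (?A \<chi>0 N) + 2 * Re (?A \<chi> N)"
      using distinct dchar_mangoldt_sum_cnj[of \<chi> N] by (simp add: \<chi>'_def[symmetric])
    also have "(\<Sum>\<psi>\<in>dchars M - {\<chi>0, \<chi>, \<chi>'}. Re (?A \<psi> N)) \<le> K"
      unfolding K_def using C N by (intro sum_mono) auto
    also have "Re (?A \<chi>0 N) \<le> 3 / 2 * ln (3 * real N)"
      unfolding \<chi>0_def by (rule Re_dchar_mangoldt_sum_principal_upper[OF N])
    also have "Re (?A \<chi> N) + ln (real N) \<le> 8 * M"
      using sum_dchar_mangoldt_L1_0[OF M \<chi> L0 N] complex_Re_le_cmod[of "?A \<chi> N + of_real (ln (real N))"]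
      unfolding dchar_mangoldt_sum_def[symmetric] by simp
    then have "Re (?A \<chi> N) \<le> 8 * M - ln (real N)" by simp
    finally have "0 \<le> K + (3 / 2 * ln (3 * real N) + 2 * (8 * M - ln (real N)))" by simp
    moreover have "ln (3 * real N) = ln 3 + ln (real N)" using N by (intro ln_mult_pos) auto
    moreover have "z / 2 \<le> 3 / 2 * y + 2 * m + k" if "0 \<le> k + (3 / 2 * x + 2 * (m - z))" "x = y + z"
      for x y z m k :: real using that by (simp add: field_simps)
    ultimately have "ln (real N) / 2 \<le> 3 / 2 * ln 3 + 2 * real (8 * M) + K" by blast
    then show ?thesis by simp
  qed
  obtain N :: nat where N: "real N > exp (2 * (3 / 2 * ln 3 + 16 * M + K))"
    using reals_Archimedean2 by blast
  then have "N > 0" using exp_gt_zero[of "2 * (3 / 2 * ln 3 + 16 * M + K)"] by (metis of_nat_0_less_iff order_less_trans)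
  moreover from N this have "2 * (3 / 2 * ln 3 + 16 * M + K) < ln (real N)"
    by (metis ln_exp ln_less_cancel_iff exp_gt_zero of_nat_0_less_iff)
  ultimately show False using bound[of N] by simp
qed

section \<open>Real characters\<close>

lemma ln_le_harmonic: "ln (real N + 1) \<le> (\<Sum>m=1..N. 1 / real m)"
proof (induction N)
  case (Suc N)
  have "1 + 1 / (real N + 1) = (real (Suc N) + 1) / (real N + 1)" by (simp add: field_simps)
  then have "ln (real (Suc N) + 1) - ln (real N + 1) = ln (1 + 1 / (real N + 1))"
    using ln_div[of "real (Suc N) + 1" "real N + 1"] by simp
  also have "\<dots> \<le> 1 / (real N + 1)" by (rule ln_add_one_self_le_self) simp
  finally show ?case using Suc by (simp add: add.commute)
qed simp

text \<open>A real character takes the values 0, 1 and -1, so the multiplicative divisor sum at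
  \<open>p ^ k\<close> is 1, \<open>k + 1\<close>, or (for the value -1) 1 or 0 by the parity of
  \<open>k\<close>. It is never negative, and at least 1 for even \<open>k\<close>, as in a
  square.\<close>

lemma real_dchar_divisor_sum:
  assumes \<chi>: "\<chi> \<in> dchars M" and real: "(\<lambda>n. cnj (\<chi> n)) = \<chi>" and M: "M > 0" and n: "n > 0"
  shows "0 \<le> (\<Sum>d | d dvd n. Re (\<chi> d))" "1 \<le> (\<Sum>d | d dvd n\<^sup>2. Re (\<chi> d))"
proof -
  have mult: "Re (\<chi> (a * b)) = Re (\<chi> a) * Re (\<chi> b)" for a b
    using fun_cong[OF real, of a] by (simp add: dchar_mult[OF \<chi>] complex_eq_iff)
  then have power: "Re (\<chi> (a ^ i)) = Re (\<chi> a) ^ i" for a i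
    by (induction i) (simp_all add: dchar_1[OF \<chi>])
  have val: "Re (\<chi> a) \<in> {0, 1, -1}" for a
  proof (cases "coprime a M")
    case True
    have "\<chi> a * \<chi> a = 1" using dchar_mult_cnj[OF \<chi> M True] fun_cong[OF real, of a] by simp
    then have "Re (\<chi> a) * Re (\<chi> a) = 1" by (metis mult dchar_mult[OF \<chi>] one_complex.sel(1))
    then show ?thesis by (simp add: square_eq_1_iff)
  qed (use dchar_eq_0_iff[OF \<chi>, of a] in simp)
  have factor: "(\<Sum>d | d dvd p ^ k * m. Re (\<chi> d)) = (\<Sum>i\<le>k. Re (\<chi> p) ^ i) * (\<Sum>d | d dvd m. Re (\<chi> d))"
    if "prime p" "\<not> p dvd m" "m > 0" for p m k
    unfolding sum_divisors_prime_power_mult[OF that]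
    by (simp add: mult power sum_product)
  have alt: "(\<Sum>i\<le>k. (- 1 :: real) ^ i) = (if even k then 1 else 0)" for k
    by (induction k) auto
  have geom: "0 \<le> (\<Sum>i\<le>k. Re (\<chi> p) ^ i)" "even k \<Longrightarrow> 1 \<le> (\<Sum>i\<le>k. Re (\<chi> p) ^ i)" for p k
  proof -
    have "(\<Sum>i\<le>k. (0::real) ^ i) = 1" by (induction k) auto
    with val[of p] alt[of k]
    show "0 \<le> (\<Sum>i\<le>k. Re (\<chi> p) ^ i)" "even k \<Longrightarrow> 1 \<le> (\<Sum>i\<le>k. Re (\<chi> p) ^ i)" by auto
  qed
  show "0 \<le> (\<Sum>d | d dvd n. Re (\<chi> d))"
    using n
  proof (induction n rule: prime_power_factor_induct)
    case (prime_power p k m)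
    then show ?case by (subst factor) (auto intro!: mult_nonneg_nonneg geom)
  qed (simp add: dchar_1[OF \<chi>])
  show "1 \<le> (\<Sum>d | d dvd n\<^sup>2. Re (\<chi> d))"
    using n
  proof (induction n rule: prime_power_factor_induct)
    case (prime_power p k m)
    have "(p ^ k * m)\<^sup>2 = p ^ (2 * k) * m\<^sup>2"
      by (simp add: power_mult_distrib power_mult mult.commute)
    moreover have "\<not> p dvd m\<^sup>2" "m\<^sup>2 > 0" using prime_power by (auto simp: prime_dvd_power_iff)
    moreover have "1 * 1 \<le> (\<Sum>i\<le>2 * k. Re (\<chi> p) ^ i) * (\<Sum>d | d dvd m\<^sup>2. Re (\<chi> d))"
      using prime_power.IH geom(2)[of "2 * k" p] by (intro mult_mono) auto
    ultimately show ?case using factor[OF prime_power.hyps(1), of "m\<^sup>2" "2 * k"] by simp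
  qed (simp add: dchar_1[OF \<chi>])
qed

text \<open>The decreasing \<open>a\<close> and the increasing \<open>b\<close> enclose the constant
  \<open>c\<close>, classically the zeta value at 1/2. A real \<open>x\<close> between
  \<open>N\<close> and \<open>N + 1\<close> is allowed because the estimate is applied to a quotient
  \<open>x\<close> and its integer part.\<close>

lemma sum_inverse_sqrt_asymp:
  obtains c :: real where
    "\<And>N x. real N \<le> x \<Longrightarrow> x \<le> real N + 1 \<Longrightarrow> x > 0 \<Longrightarrow>
       \<bar>(\<Sum>k=1..N. 1 / sqrt (real k)) - 2 * sqrt x - c\<bar> \<le> 2 / sqrt x"
proof -
  define H where "H N = (\<Sum>k=1..N. 1 / sqrt (real k))" for N
  define a b where "a N = H N - 2 * sqrt (real N)" and "b N = H N - 2 * sqrt (real N + 1)" for N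
  have step: "1 / sqrt (x + 1) \<le> 2 * (sqrt (x + 1) - sqrt x)" "2 * (sqrt (x + 1) - sqrt x) \<le> 2 / sqrt (x + 1)"
    "x > 0 \<Longrightarrow> 2 * (sqrt (x + 1) - sqrt x) \<le> 1 / sqrt x" if x: "x \<ge> 0" for x :: real
  proof -
    have "(sqrt (x + 1) - sqrt x) * (sqrt (x + 1) + sqrt x) = 1"
      using x by (simp add: algebra_simps)
    then have eq: "sqrt (x + 1) - sqrt x = 1 / (sqrt (x + 1) + sqrt x)"
      using x by (metis add_pos_nonneg less_irrefl nonzero_eq_divide_eq real_sqrt_ge_0_iff real_sqrt_gt_0_iff add_nonneg_pos zero_less_one)
    have le: "sqrt x \<le> sqrt (x + 1)" by simp
    show "1 / sqrt (x + 1) \<le> 2 * (sqrt (x + 1) - sqrt x)"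
      unfolding eq using x le by (simp add: divide_simps add_pos_nonneg)
    show "2 * (sqrt (x + 1) - sqrt x) \<le> 2 / sqrt (x + 1)"
      unfolding eq using x by (simp add: divide_left_mono add_pos_nonneg)
    show "2 * (sqrt (x + 1) - sqrt x) \<le> 1 / sqrt x" if "x > 0"
    proof -
      have "1 / (sqrt (x + 1) + sqrt x) \<le> 1 / (2 * sqrt x)"
        using that le by (intro divide_left_mono) (auto intro!: mult_pos_pos add_pos_pos)
      then show ?thesis unfolding eq by simp
    qed
  qed
  have a_mono: "decseq a"
    using step(1)[of "real N" for N] by (intro decseq_SucI) (simp add: a_def H_def add.commute algebra_simps)
  have b_mono: "incseq b"
  proof (rule incseq_SucI)
    fix N
    show "b N \<le> b (Suc N)" using step(3)[of "real N + 1"] by (simp add: b_def H_def add.commute)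
  qed
  have ba: "b N \<le> a N" for N by (simp add: a_def b_def)
  have "b i \<le> a 0" for i
    using ba decseqD[OF a_mono le0] by (rule order.trans)
  then obtain c where c: "b \<longlonglongrightarrow> c" "\<And>i. b i \<le> c"
    using incseq_convergent[OF b_mono] by blast
  have ca: "c \<le> a i" for i
  proof (rule LIMSEQ_le_const2[OF c(1)])
    show "\<exists>N. \<forall>n\<ge>N. b n \<le> a i"
      using ba decseqD[OF a_mono] order.trans by blast
  qed
  show ?thesis
  proof
    fix N x assume x: "real N \<le> x" "x \<le> real N + 1" "x > 0"
    have "b N \<le> H N - 2 * sqrt x" "H N - 2 * sqrt x \<le> a N"
      using x by (simp_all add: a_def b_def)
    then have "\<bar>H N - 2 * sqrt x - c\<bar> \<le> a N - b N" using c(2)[of N] ca[of N] by linarith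
    also have "\<dots> \<le> 2 / sqrt (real N + 1)"
      using step(2)[of "real N"] by (simp add: a_def b_def)
    also have "\<dots> \<le> 2 / sqrt x" using x by (intro divide_left_mono) auto
    finally show "\<bar>(\<Sum>k=1..N. 1 / sqrt (real k)) - 2 * sqrt x - c\<bar> \<le> 2 / sqrt x"
      by (simp add: H_def)
  qed
qed

text \<open>
  The coefficients \<open>(\<Sum>d | d dvd n. \<chi> d)\<close> are nonnegative and at least 1 on squares, so their sum
  weighted by \<open>1 / sqrt n\<close> diverges; Dirichlet's hyperbola method shows that it would stay bounded
  if \<open>L(1, \<chi>)\<close> vanished.
\<close>
lemma dirichlet_L1_real_nonzero:
  assumes M: "M > 0" and \<chi>: "\<chi> \<in> dchars M" "\<chi> \<noteq> principal_dchar M"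
    and real: "(\<lambda>n. cnj (\<chi> n)) = \<chi>"
  shows "dirichlet_L1 \<chi> \<noteq> 0"
proof
  assume L0: "dirichlet_L1 \<chi> = 0"
  obtain c :: real where c: "\<And>N x. real N \<le> x \<Longrightarrow> x \<le> real N + 1 \<Longrightarrow> x > 0 \<Longrightarrow>
       \<bar>(\<Sum>k=1..N. 1 / sqrt (real k)) - 2 * sqrt x - c\<bar> \<le> 2 / sqrt x"
    using sum_inverse_sqrt_asymp by blast
  define H where "H N = (\<Sum>k=1..N. 1 / sqrt (real k))" for N
  define w where "w d = \<chi> d * of_real (1 / sqrt (real d))" for d
  have w: "norm (\<Sum>d=m..<n. w d) \<le> 2 * real M * (1 / sqrt (real m))" if "m > 0" "m \<le> n" for m n
    unfolding w_def using that
    by (intro norm_sum_antimono_le norm_sum_dchar_le[OF M \<chi>]) (auto simp: divide_left_mono)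
  \<comment> \<open>The cutoff is a square so that the hyperbola has its corner at
    \<open>d = k = N\<close> and the squares of all \<open>m \<le> N\<close> lie in range.\<close>
  define D where "D N = (\<Sum>n=1..N\<^sup>2. (\<Sum>d | d dvd n. Re (\<chi> d)) / sqrt (real n))" for N
  have lower: "(\<Sum>m=1..N. 1 / real m) \<le> D N" for N
  proof -
    have "(\<Sum>m=1..N. 1 / real m) \<le> (\<Sum>m=1..N. (\<Sum>d | d dvd m\<^sup>2. Re (\<chi> d)) / sqrt (real (m\<^sup>2)))"
      using real_dchar_divisor_sum(2)[OF \<chi>(1) real M] by (intro sum_mono) (auto intro!: divide_right_mono)
    also have "\<dots> = (\<Sum>n\<in>(\<lambda>m. m\<^sup>2) ` {1..N}. (\<Sum>d | d dvd n. Re (\<chi> d)) / sqrt (real n))"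
      by (subst sum.reindex) (auto simp: inj_on_def)
    also have "\<dots> \<le> D N"
      unfolding D_def using real_dchar_divisor_sum(1)[OF \<chi>(1) real M]
      by (intro sum_mono2) (auto simp: power_mono)
    finally show ?thesis .
  qed
  \<comment> \<open>The summands bound, in order, the main term, the contribution of
    \<open>c\<close>, the rounding errors \<open>e d\<close>, and the range
    \<open>d > N\<close>.\<close>
  define K where "K = 4 * M + \<bar>c\<bar> * (2 * M) + 2 + 4 * M"
  have upper: "D N \<le> K" if N: "N > 0" for N
  proof -
    have "of_real (D N) = (\<Sum>n=1..N\<^sup>2. \<Sum>d | d dvd n. w d * of_real (1 / sqrt (real (n div d))))"
      unfolding D_def of_real_sum
    proof (intro sum.cong refl)
      fix n assume n: "n \<in> {1..N\<^sup>2}"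
      have "of_real (Re (\<chi> d)) = \<chi> d" for d using fun_cong[OF real, of d] by (simp add: complex_eq_iff)
      then have "of_real ((\<Sum>d | d dvd n. Re (\<chi> d)) / sqrt (real n)) = (\<Sum>d | d dvd n. \<chi> d * of_real (1 / sqrt (real n)))"
        by (simp add: sum_divide_distrib)
      also have "\<dots> = (\<Sum>d | d dvd n. w d * of_real (1 / sqrt (real (n div d))))"
        unfolding w_def using n by (intro sum.cong) (auto elim!: dvdE simp: real_sqrt_mult)
      finally show "of_real ((\<Sum>d | d dvd n. Re (\<chi> d)) / sqrt (real n)) = (\<Sum>d | d dvd n. w d * of_real (1 / sqrt (real (n div d))))" .
    qed
    also have "\<dots> = (\<Sum>d=1..N\<^sup>2. \<Sum>k=1..N\<^sup>2 div d. w d * of_real (1 / sqrt (real k)))"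
      by (rule sum_up_to_divisors)
    \<comment> \<open>The hyperbola split: \<open>d > N\<close> forces \<open>k \<le> N\<close>, so
      on that range the sum over \<open>d\<close> can be made the inner one, where Abel summation
      exploits the cancellation in \<chi>.\<close>
    also have "\<dots> = (\<Sum>d=1..N. \<Sum>k=1..N\<^sup>2 div d. w d * of_real (1 / sqrt (real k)))
                + (\<Sum>d=N+1..N\<^sup>2. \<Sum>k=1..N\<^sup>2 div d. w d * of_real (1 / sqrt (real k)))"
    proof -
      have "N \<le> N\<^sup>2" by (simp add: power2_eq_square)
      then show ?thesis using N sum.ub_add_nat[where m = 1 and n = N and p = "N\<^sup>2 - N"] by simp
    qed
    also have "(\<Sum>d=N+1..N\<^sup>2. \<Sum>k=1..N\<^sup>2 div d. w d * of_real (1 / sqrt (real k)))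
        = (\<Sum>k=1..N. \<Sum>d=N+1..<N\<^sup>2 div k + 1. w d * of_real (1 / sqrt (real k)))"
    proof -
      let ?g = "\<lambda>d k. w d * of_real (1 / sqrt (real k))"
      have le: "k \<le> N \<and> d \<le> N\<^sup>2" if "N < d" "0 < k" "k * d \<le> N\<^sup>2" for d k
      proof
        show "k \<le> N"
        proof (rule ccontr)
          assume "\<not> k \<le> N"
          then have "N * N < k * d" using \<open>N < d\<close> by (intro mult_strict_mono) auto
          then show False using that by (simp add: power2_eq_square)
        qed
        have "d \<le> k * d" using that by (cases k) auto
        then show "d \<le> N\<^sup>2" using that(3) by (rule order.trans)
      qed
      have k_set: "{1..N\<^sup>2 div d} = {k\<in>{1..N}. k * d \<le> N\<^sup>2}" if "d \<in> {N+1..N\<^sup>2}" for d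
        using that le[of d] by (auto simp: less_eq_div_iff_mult_less_eq)
      have d_set: "{d\<in>{N+1..N\<^sup>2}. k * d \<le> N\<^sup>2} = {N+1..<N\<^sup>2 div k + 1}" if "k \<in> {1..N}" for k
        using that le[of _ k] by (auto simp: less_eq_div_iff_mult_less_eq less_Suc_eq_le mult.commute)
      have "(\<Sum>d=N+1..N\<^sup>2. \<Sum>k=1..N\<^sup>2 div d. ?g d k) = (\<Sum>d=N+1..N\<^sup>2. \<Sum>k | k \<in> {1..N} \<and> k * d \<le> N\<^sup>2. ?g d k)"
        using k_set by (intro sum.cong) auto
      also have "\<dots> = (\<Sum>k=1..N. \<Sum>d | d \<in> {N+1..N\<^sup>2} \<and> k * d \<le> N\<^sup>2. ?g d k)"
        by (rule sum.swap_restrict) auto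
      also have "\<dots> = (\<Sum>k=1..N. \<Sum>d=N+1..<N\<^sup>2 div k + 1. ?g d k)"
        using d_set by (intro sum.cong) auto
      finally show ?thesis .
    qed
    finally have D: "of_real (D N) = (\<Sum>d=1..N. w d * of_real (H (N\<^sup>2 div d)))
        + (\<Sum>k=1..N. (\<Sum>d=N+1..<N\<^sup>2 div k + 1. w d) * of_real (1 / sqrt (real k)))"
      unfolding H_def of_real_sum sum_distrib_left sum_distrib_right .
    have part2: "norm (\<Sum>k=1..N. (\<Sum>d=N+1..<N\<^sup>2 div k + 1. w d) * of_real (1 / sqrt (real k))) \<le> 4 * M"
    proof -
      have "norm (\<Sum>k=1..N. (\<Sum>d=N+1..<N\<^sup>2 div k + 1. w d) * of_real (1 / sqrt (real k)))
          \<le> (\<Sum>k=1..N. 2 * real M * (1 / sqrt N) * (1 / sqrt (real k)))"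
      proof (rule sum_norm_le)
        fix k assume k: "k \<in> {1..N}"
        have "N * k \<le> N\<^sup>2" using k by (simp add: power2_eq_square)
        then have "N \<le> N\<^sup>2 div k" using k by (simp add: less_eq_div_iff_mult_less_eq)
        then have "norm (\<Sum>d=N+1..<N\<^sup>2 div k + 1. w d) \<le> 2 * real M * (1 / sqrt (real (N + 1)))"
          by (intro w) auto
        also have "\<dots> \<le> 2 * real M * (1 / sqrt N)" using N by (intro mult_left_mono divide_left_mono) auto
        finally show "norm ((\<Sum>d=N+1..<N\<^sup>2 div k + 1. w d) * of_real (1 / sqrt (real k)))
            \<le> 2 * real M * (1 / sqrt N) * (1 / sqrt (real k))"
          unfolding norm_mult norm_of_real by (intro mult_mono) auto
      qed
      also have "\<dots> \<le> 2 * real M * (1 / sqrt N) * (2 * sqrt N)"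
        unfolding sum_distrib_left[symmetric] by (intro mult_left_mono sum_inverse_sqrt_le) auto
      also have "\<dots> = 4 * M" using N by simp
      finally show ?thesis .
    qed
    define e where "e d = H (N\<^sup>2 div d) - 2 * (N / sqrt d) - c" for d
    have e: "\<bar>e d\<bar> \<le> 2 * (sqrt d / N)" if "d \<in> {1..N}" for d
    proof -
      have "real (N\<^sup>2 div d) \<le> real (N\<^sup>2) / d" by (rule of_nat_div_le_of_nat)
      moreover have "real (N\<^sup>2) / d \<le> real (N\<^sup>2 div d) + 1" using that by (intro nat_div_plus_1_ge) auto
      moreover have "real (N\<^sup>2) / d > 0" using that N by auto
      ultimately have "\<bar>H (N\<^sup>2 div d) - 2 * sqrt (real (N\<^sup>2) / d) - c\<bar> \<le> 2 / sqrt (real (N\<^sup>2) / d)"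
        unfolding H_def by (rule c)
      then show ?thesis by (simp add: e_def real_sqrt_divide)
    qed
    \<comment> \<open>The part \<open>2 * N / sqrt d\<close> of \<open>H\<close> combines with
      \<open>w d\<close> to \<open>2 * N\<close> times a partial sum of the L-series. It stays
      bounded because the series sums to 0 with error of order \<open>1 / N\<close>.\<close>
    have "(\<Sum>d=1..N. w d * of_real (H (N\<^sup>2 div d)))
        = (\<Sum>d=1..N. 2 * of_nat N * (\<chi> d * of_real (1 / real d)) + of_real c * w d + w d * of_real (e d))"
    proof (rule sum.cong)
      fix d assume "d \<in> {1..N}"
      then have "1 / sqrt (real d) * (1 / sqrt (real d)) = 1 / real d" by simp
      then have "w d * of_real (1 / sqrt (real d)) = \<chi> d * of_real (1 / real d)"
        unfolding w_def mult.assoc of_real_mult[symmetric] by simp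
      moreover have "H (N\<^sup>2 div d) = 2 * real N * (1 / sqrt (real d)) + c + e d" by (simp add: e_def)
      moreover have "x * (2 * n * s + b + t) = 2 * n * (x * s) + b * x + x * t" for x n s b t :: complex
        by (simp add: algebra_simps)
      ultimately show "w d * of_real (H (N\<^sup>2 div d))
          = 2 * of_nat N * (\<chi> d * of_real (1 / real d)) + of_real c * w d + w d * of_real (e d)"
        by (simp only: of_real_add of_real_mult of_real_numeral of_real_of_nat_eq)
    qed simp
    also have "\<dots> = 2 * of_nat N * (\<Sum>d=1..N. \<chi> d * of_real (1 / real d)) + of_real c * (\<Sum>d=1..N. w d)
        + (\<Sum>d=1..N. w d * of_real (e d))"
      by (simp only: sum.distrib sum_distrib_left)
    also have "norm \<dots> \<le> 2 * N * (2 * M / N) + \<bar>c\<bar> * (2 * M) + 2"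
    proof (intro norm_triangle_le add_mono)
      have "norm (\<Sum>d=1..N. \<chi> d * of_real (1 / real d)) \<le> 2 * M / (N + 1)"
        using dirichlet_L1_partial_sum[OF M \<chi>, of N] L0 by (simp add: add.commute)
      also have "\<dots> \<le> 2 * M / N" using N by (intro divide_left_mono) auto
      finally show "norm (2 * of_nat N * (\<Sum>d=1..N. \<chi> d * of_real (1 / real d))) \<le> 2 * N * (2 * M / N)"
        unfolding norm_mult by (intro mult_mono) auto
      have "norm (\<Sum>d=1..N. w d) \<le> 2 * M" using w[of 1 "Suc N"] by (simp add: atLeastLessThanSuc_atLeastAtMost)
      then show "norm (of_real c * (\<Sum>d=1..N. w d)) \<le> \<bar>c\<bar> * (2 * M)"
        unfolding norm_mult by (intro mult_mono) auto
      have "norm (\<Sum>d=1..N. w d * of_real (e d)) \<le> (\<Sum>d=1..N. 2 / N)"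
      proof (rule sum_norm_le)
        fix d assume d: "d \<in> {1..N}"
        have "norm (w d * of_real (e d)) \<le> (1 * (1 / sqrt d)) * (2 * (sqrt d / N))"
          unfolding w_def norm_mult norm_of_real using e[OF d] norm_dchar_le[OF \<chi>(1) M, of d]
          by (intro mult_mono) auto
        also have "\<dots> = 2 / N" using d by simp
        finally show "norm (w d * of_real (e d)) \<le> 2 / N" .
      qed
      then show "norm (\<Sum>d=1..N. w d * of_real (e d)) \<le> 2" using N by simp
    qed
    also have "\<dots> = 4 * M + \<bar>c\<bar> * (2 * M) + 2" using N by simp
    finally have "norm (of_real (D N) :: complex) \<le> K"
      unfolding D K_def by (intro norm_triangle_le add_mono part2)
    then show ?thesis by simp
  qed
  obtain n :: nat where n: "real n > exp K" using reals_Archimedean2 by blast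
  then have "n > 0" by (cases n) auto
  have "K = ln (exp K)" by simp
  also have "\<dots> < ln (real n + 1)" using n by (intro ln_less_cancel_iff[THEN iffD2]) (auto intro: add_pos_pos less_trans)
  finally show False using ln_le_harmonic[of n] lower[of n] upper[OF \<open>n > 0\<close>] by simp
qed

section \<open>Dirichlet's theorem\<close>

lemma dirichlet_L1_nonzero:
  assumes "M > 0" "\<chi> \<in> dchars M" "\<chi> \<noteq> principal_dchar M"
  shows "dirichlet_L1 \<chi> \<noteq> 0"
  using dirichlet_L1_real_nonzero[OF assms] dirichlet_L1_nonreal_nonzero[OF assms] by blast

text \<open>Orthogonality isolates the class of \<open>a\<close>. The principal character
  contributes at least \<open>ln N\<close> minus a constant and all others stay bounded, so the
  weighted class sum is unbounded; nonprimes and finitely many primes could give only a bounded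
  one.\<close>

theorem infinite_primes_in_progression:
  assumes M: "M > 0" and a: "coprime a M"
  shows "infinite {q :: nat. prime q \<and> [q = a] (mod M)}"
proof
  assume fin: "finite {q :: nat. prime q \<and> [q = a] (mod M)}" (is "finite ?Q")
  define \<chi>0 where "\<chi>0 = principal_dchar M"
  let ?A = dchar_mangoldt_sum and ?f = "\<lambda>n. mangoldt n / real n :: real"
  have "\<forall>\<chi>\<in>dchars M - {\<chi>0}. \<exists>c. \<forall>N. norm (?A \<chi> N) \<le> c"
  proof
    fix \<chi> assume "\<chi> \<in> dchars M - {\<chi>0}"
    then have \<chi>: "\<chi> \<in> dchars M" "\<chi> \<noteq> principal_dchar M" by (auto simp: \<chi>0_def)
    then show "\<exists>c. \<forall>N. norm (?A \<chi> N) \<le> c"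
      using sum_dchar_mangoldt_bounded[OF M \<chi> dirichlet_L1_nonzero[OF M \<chi>]]
      unfolding dchar_mangoldt_sum_def by blast
  qed
  from bchoice[OF this] obtain C where "\<forall>\<chi>\<in>dchars M - {\<chi>0}. \<forall>N. norm (?A \<chi> N) \<le> C \<chi>" ..
  then have C: "norm (?A \<chi> N) \<le> C \<chi>" if "\<chi> \<in> dchars M - {\<chi>0}" for \<chi> N
    using that by blast
  obtain C0 where C0: "\<And>N. N > 0 \<Longrightarrow> ln (real N) - C0 \<le> Re (?A \<chi>0 N)"
    using Re_dchar_mangoldt_sum_principal_lower[OF M] unfolding \<chi>0_def by blast
  have \<chi>0: "\<chi>0 \<in> dchars M" "cnj (\<chi>0 a) = 1"
    using principal_dchar_in_dchars[OF M] a by (simp_all add: \<chi>0_def principal_dchar_def)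
  define K where "K = C0 + (\<Sum>\<chi>\<in>dchars M - {\<chi>0}. C \<chi>) + card (dchars M) * (8 + (\<Sum>n\<in>?Q. ?f n))"
  have bound: "ln (real N) \<le> K" if N: "N > 0" for N
  proof -
    define X where "X = (\<Sum>n\<in>{n\<in>{1..N}. [n = a] (mod M)}. ?f n)"
    have "X \<le> (\<Sum>n\<in>{n\<in>{1..N}. \<not> prime n} \<union> ?Q. ?f n)"
      unfolding X_def using fin by (intro sum_mono2) (auto simp: mangoldt_nonneg)
    also have "\<dots> \<le> (\<Sum>n\<in>{n\<in>{1..N}. \<not> prime n}. ?f n) + (\<Sum>n\<in>?Q. ?f n)"
      using fin by (subst sum_Un) (auto intro!: sum_nonneg simp: mangoldt_nonneg)
    also have "\<dots> \<le> 8 + (\<Sum>n\<in>?Q. ?f n)"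
      using sum_mangoldt_nonprime_le[of N] by simp
    finally have X: "X \<le> 8 + (\<Sum>n\<in>?Q. ?f n)" .
    have "of_real (card (dchars M) * X) = (\<Sum>\<chi>\<in>dchars M. cnj (\<chi> a) * ?A \<chi> N)"
      unfolding X_def by (rule sum_dchar_mangoldt_sums[OF M a, symmetric])
    also have "\<dots> = ?A \<chi>0 N + (\<Sum>\<chi>\<in>dchars M - {\<chi>0}. cnj (\<chi> a) * ?A \<chi> N)"
      using \<chi>0 by (subst sum.remove[OF finite_dchars[OF M] \<chi>0(1)]) simp
    finally have "Re (of_real (card (dchars M) * X)) = Re (?A \<chi>0 N + (\<Sum>\<chi>\<in>dchars M - {\<chi>0}. cnj (\<chi> a) * ?A \<chi> N))"
      by (rule arg_cong)
    then have "Re (?A \<chi>0 N) = card (dchars M) * X - Re (\<Sum>\<chi>\<in>dchars M - {\<chi>0}. cnj (\<chi> a) * ?A \<chi> N)"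
      unfolding Re_complex_of_real plus_complex.sel by linarith
    also have "\<dots> \<le> card (dchars M) * X + norm (\<Sum>\<chi>\<in>dchars M - {\<chi>0}. cnj (\<chi> a) * ?A \<chi> N)"
      using abs_Re_le_cmod[of "\<Sum>\<chi>\<in>dchars M - {\<chi>0}. cnj (\<chi> a) * ?A \<chi> N"] by linarith
    also have "norm (\<Sum>\<chi>\<in>dchars M - {\<chi>0}. cnj (\<chi> a) * ?A \<chi> N) \<le> (\<Sum>\<chi>\<in>dchars M - {\<chi>0}. C \<chi>)"
    proof (rule sum_norm_le)
      fix \<chi> assume \<chi>: "\<chi> \<in> dchars M - {\<chi>0}"
      then show "norm (cnj (\<chi> a) * ?A \<chi> N) \<le> C \<chi>"
        using C[OF \<chi>] norm_dchar[of \<chi> M a] M a by (simp add: norm_mult)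
    qed
    also have "card (dchars M) * X \<le> card (dchars M) * (8 + (\<Sum>n\<in>?Q. ?f n))"
      using X by (intro mult_left_mono) auto
    finally show ?thesis using C0[OF N] unfolding K_def by linarith
  qed
  obtain n :: nat where n: "real n > exp K" using reals_Archimedean2 by blast
  then have "n > 0" by (cases n) auto
  moreover from this have "K < ln (real n)" using n ln_less_cancel_iff[of "exp K" "real n"] by simp
  ultimately show False using bound[of n] by simp
qed

corollary prime_in_progression:
  assumes "M > 0" "coprime a M"
  obtains q :: nat where "prime q" "[q = a] (mod M)" "q > b"
proof -
  have "\<not> {q. prime q \<and> [q = a] (mod M)} \<subseteq> {..b}"
    using infinite_primes_in_progression[OF assms] finite_subset by blast
  then obtain q where "prime q" "[q = a] (mod M)" "\<not> q \<le> b" by blast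
  then show ?thesis using that[of q] by simp
qed

section \<open>Binomial coefficients\<close>

lemma binomial_mult_fact_eq_prod: "(w + n choose n) * fact n = (\<Prod>j=1..n. w + j)"
proof (induction n)
  case (Suc n)
  have "(w + Suc n choose Suc n) * fact (Suc n) = (Suc (w + n) * (w + n choose n)) * fact n"
    using Suc_times_binomial_eq[of "w + n" n] by (simp add: algebra_simps)
  also have "\<dots> = (\<Prod>j=1..n. w + j) * (w + Suc n)"
    using Suc.IH by (simp add: algebra_simps)
  finally show ?case by simp
qed simp

text \<open>The product \<open>fact n * (x choose n)\<close> of shifts of \<open>x\<close> respects
  congruences. Dividing by \<open>d\<close> shrinks the modulus from \<open>d * m\<close> to
  \<open>m\<close>, after which the coprime factor \<open>c\<close> can be cancelled.\<close>

lemma cong_binomial: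
  fixes m d c :: nat
  assumes fact: "fact n = d * c" "coprime c m" and "m > 0"
    and xy: "[x = y] (mod d * m)" "x \<ge> n" "y \<ge> n"
  shows "[x choose n = y choose n] (mod m)"
proof -
  have "[(\<Prod>j=1..n. (x - n) + j) = (\<Prod>j=1..n. (y - n) + j)] (mod d * m)"
  proof (intro cong_prod)
    fix j
    have "[(x - n) + n = (y - n) + n] (mod d * m)" using xy by simp
    then have "[x - n = y - n] (mod d * m)" by (rule cong_add_rcancel_nat[THEN iffD1])
    then show "[(x - n) + j = (y - n) + j] (mod d * m)" by (intro cong_add cong_refl)
  qed
  then have "[d * ((x choose n) * c) = d * ((y choose n) * c)] (mod d * m)"
    unfolding binomial_mult_fact_eq_prod[symmetric] using xy fact(1) by (simp add: mult_ac)
  moreover have "d \<noteq> 0" using fact(1) by (metis fact_nonzero mult_zero_left)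
  ultimately have "[(x choose n) * c = (y choose n) * c] (mod m)"
    by (simp add: cong_def mod_mult_mult1)
  then show ?thesis using fact(2) by (simp add: cong_mult_rcancel_nat)
qed

text \<open>In Vandermonde's sum for \<open>p + s\<close> every \<open>p choose k\<close> with
  \<open>0 < k < p\<close> is divisible by \<open>p\<close>; the outer terms \<open>k = 0\<close>
  and \<open>k = p\<close> give \<open>s choose p\<close> and 1.\<close>

lemma prime_binomial_cong_div:
  fixes p :: nat
  assumes p: "prime p"
  shows "[q choose p = q div p] (mod p)"
proof (induction q rule: less_induct)
  case (less q)
  have p0: "p > 0" using p by (rule prime_gt_0_nat)
  show ?case
  proof (cases "q < p")
    case False
    define s where "s = q - p"
    have q: "q = p + s" using False by (simp add: s_def)
    have "[(\<Sum>k\<le>p. (p choose k) * (s choose (p - k))) = (\<Sum>k\<le>p. if k = 0 then s choose p else if k = p then 1 else 0)] (mod p)"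
    proof (intro cong_sum)
      fix k assume k: "k \<in> {..p}"
      show "[(p choose k) * (s choose (p - k)) = (if k = 0 then s choose p else if k = p then 1 else 0)] (mod p)"
      proof (cases "0 < k \<and> k < p")
        case True
        then have "p dvd (p choose k) * (s choose (p - k))"
          using p by (intro dvd_mult2 dvd_choose_prime) auto
        then show ?thesis using True by (simp add: cong_0_iff)
      qed (use k in auto)
    qed
    also have "(\<Sum>k\<le>p. if k = 0 then s choose p else if k = p then 1 else 0) = (\<Sum>k\<in>{0, p}. if k = 0 then s choose p else if k = p then 1 else 0)"
      by (rule sum.mono_neutral_right) auto
    also have "\<dots> = (s choose p) + 1" using p0 by simp
    finally have "[q choose p = (s choose p) + 1] (mod p)"
      unfolding q vandermonde[symmetric] .
    also have "[(s choose p) + 1 = s div p + 1] (mod p)"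
      using less.IH[of s] q p0 by (intro cong_add cong_refl) auto
    also have "s div p + 1 = q div p" using p0 by (simp add: q)
    finally show ?thesis .
  qed (simp add: binomial_eq_0)
qed

text \<open>Here \<open>q \<equiv> -1\<close>, so that \<open>q choose n\<close> behaves like \<open>-1 choose n = 1\<close> and \<open>q div n\<close> like \<open>-1\<close>.\<close>
lemma even_binomial_div_counterexample:
  fixes n :: nat
  assumes n: "even n" "n > 2"
  obtains q where "prime q" "\<not> [q choose n = q div n] (mod n)"
proof -
  \<comment> \<open>The factor \<open>fact n\<close> allows \<open>q + 1\<close> to be divided by
    any positive \<open>i \<le> n\<close> and still leave a multiple of \<open>n\<close>.\<close>
  define M where "M = n * fact n"
  have M0: "M > 0" using n by (simp add: M_def)
  have "coprime (M - 1) M" using M0 by (rule coprime_diff_one_left_nat)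
  then obtain q where q: "prime q" "[q = M - 1] (mod M)"
    using prime_in_progression[OF M0, of "M - 1" 0] by blast
  have "[q + 1 = (M - 1) + 1] (mod M)" using q(2) by (intro cong_add cong_refl)
  then have "M dvd q + 1" using M0 by (simp add: cong_def mod_eq_0_iff_dvd)
  then obtain t where t: "q + 1 = M * t" by (elim dvdE)
  have t0: "t > 0" using t by (cases t) auto
  \<comment> \<open>By Pascal's rule consecutive binomials add up to
    \<open>Suc q choose Suc i\<close>, a multiple of \<open>n\<close> by the choice of
    \<open>M\<close>, so the sign alternates.\<close>
  have binom: "[int (q choose i) = (-1) ^ i] (mod int n)" if "i \<le> n" for i
    using that
  proof (induction i)
    case (Suc i)
    have "Suc i dvd fact n" using Suc.prems by (intro dvd_fact) auto
    then obtain c where c: "fact n = Suc i * c" by (elim dvdE)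
    have "Suc i * (Suc q choose Suc i) = Suc i * (n * (c * t * (q choose i)))"
    proof -
      have "Suc i * (Suc q choose Suc i) = Suc q * (q choose i)"
        using Suc_times_binomial_eq[of q i] by (simp only: mult.commute)
      moreover have "Suc q = n * (Suc i * c) * t" using t by (simp only: M_def c Suc_eq_plus1)
      then have "Suc q * (q choose i) = n * (Suc i * c) * t * (q choose i)" by (rule arg_cong)
      ultimately show ?thesis by (simp only: mult_ac)
    qed
    then have "Suc q choose Suc i = n * (c * t * (q choose i))"
      by (simp only: mult_cancel1) simp
    then have "int n dvd int (q choose i) + int (q choose Suc i)"
      by (metis binomial_Suc_Suc dvd_triv_left of_nat_add of_nat_dvd_iff)
    then have "[int (q choose Suc i) = - int (q choose i)] (mod int n)"
      by (simp add: cong_iff_dvd_diff add.commute)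
    also have "[- int (q choose i) = - ((-1) ^ i)] (mod int n)"
      using Suc by (simp add: cong_minus_minus_iff)
    finally show ?case by simp
  qed simp
  have "q div n + 1 = (q + n) div n" using n by simp
  also have "q + n = n * (fact n * t) + (n - 1)"
    using t n unfolding M_def by (simp add: mult.assoc)
  also have "(n * (fact n * t) + (n - 1)) div n = fact n * t"
    using n by (subst div_mult_self4) auto
  finally have div: "q div n + 1 = fact n * t" .
  \<comment> \<open>The number \<open>q div n + 1\<close> is a multiple of \<open>n\<close>, whereas
    \<open>(q choose n) + 1\<close> is 2 modulo \<open>n\<close> because \<open>n\<close> is even;
    \<open>n > 2\<close> separates them.\<close>
  have not: "\<not> [q choose n = q div n] (mod n)"
  proof
    assume "[q choose n = q div n] (mod n)"
    then have "[int (q choose n) + 1 = int (q div n) + 1] (mod int n)"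
      by (intro cong_add cong_refl) (simp add: cong_int_iff)
    also have "int (q div n) + 1 = int (fact n * t)" using div by linarith
    also have "[int (fact n * t) = 0] (mod int n)"
    proof -
      have "n dvd fact n * t" using n by (intro dvd_mult2 dvd_fact) auto
      then show ?thesis by (simp only: cong_0_iff of_nat_dvd_iff)
    qed
    finally have "[int (q choose n) + 1 = 0] (mod int n)" .
    moreover have "[int (q choose n) + 1 = (-1) ^ n + 1] (mod int n)"
      using binom[of n] by (intro cong_add cong_refl) simp
    ultimately have "[(-1) ^ n + 1 = 0] (mod int n)" using cong_sym cong_trans by blast
    then have "int n dvd 2" using n by (simp add: cong_0_iff)
    then have "int n \<le> 2" by (intro zdvd_imp_le) auto
    then show False using n by simp
  qed
  show ?thesis using that q(1) not by blast
qed

text \<open>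
  In \<open>n + r + 1 choose r + 1 = (\<Prod>i = 1..r + 1. 1 + n / i)\<close> only the factor with \<open>i = r\<close> differs
  from 1 modulo a power of \<open>r\<close> dividing \<open>n\<close>.
\<close>
lemma binomial_prime_factor_cong:
  fixes n r a :: nat
  assumes r: "prime r" and a: "r ^ a dvd n" and rn: "r dvd n"
  shows "[n + (r + 1) choose n = n div r + 1] (mod r ^ a)"
proof -
  define I where "I = {1..r + 1} - {r}"
  have r2: "r \<ge> 2" using r by (rule prime_ge_2_nat)
  have split: "(\<Prod>i=1..r+1. f i) = f r * (\<Prod>i\<in>I. f i)" for f :: "nat \<Rightarrow> nat"
    unfolding I_def using r2 by (intro prod.remove) auto
  have "(n + (r + 1) choose (r + 1)) * fact (r + 1) = (\<Prod>i=1..r+1. n + i)"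
    by (rule binomial_mult_fact_eq_prod)
  then have "r * ((n + (r + 1) choose (r + 1)) * \<Prod>I) = (n + r) * (\<Prod>i\<in>I. n + i)"
    unfolding fact_prod split of_nat_id by (simp add: mult_ac)
  also have "n + r = r * (n div r + 1)" using rn by (simp add: algebra_simps)
  finally have eq: "(n + (r + 1) choose (r + 1)) * \<Prod>I = (n div r + 1) * (\<Prod>i\<in>I. n + i)"
    using r2 by (simp only: mult.assoc mult_cancel1) simp
  have "[(\<Prod>i\<in>I. n + i) = (\<Prod>i\<in>I. 0 + i)] (mod r ^ a)"
    using a by (intro cong_prod cong_add) (auto simp: cong_0_iff)
  then have "[(n + (r + 1) choose (r + 1)) * \<Prod>I = (n div r + 1) * \<Prod>I] (mod r ^ a)"
    unfolding eq by (intro cong_mult cong_refl) simp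
  moreover have "coprime (\<Prod>I) (r ^ a)"
  proof -
    have "\<not> r dvd i" if "i \<in> I" for i
    proof
      assume "r dvd i"
      then obtain k where "i = r * k" by (elim dvdE)
      then show False using that r2 unfolding I_def by (cases k; cases "k - 1") auto
    qed
    then show ?thesis
      using r by (intro prod_coprime_left) (metis prime_imp_coprime coprime_commute coprime_power_right_iff)
  qed
  ultimately have "[n + (r + 1) choose (r + 1) = n div r + 1] (mod r ^ a)"
    using cong_mult_rcancel_nat by blast
  then show ?thesis using binomial_symmetric[of "r + 1" "n + (r + 1)"] by simp
qed

text \<open>Modulo \<open>r ^ a\<close>, \<open>q choose n\<close> is \<open>n div r + 1\<close> and
  \<open>q div n\<close> is 1. These differ because \<open>r ^ a\<close> is the full power of
  \<open>r\<close> in \<open>n\<close> and hence does not divide \<open>n div r\<close>.\<close>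

lemma odd_binomial_div_counterexample:
  fixes n :: nat
  assumes n: "odd n" "n > 1" "\<not> prime n"
  obtains q where "prime q" "\<not> [q choose n = q div n] (mod n)"
proof -
  define r where "r = (LEAST r. prime r \<and> r dvd n)"
  have "\<exists>r. prime r \<and> r dvd n" using n prime_factor_nat[of n] by auto
  then have r: "prime r" "r dvd n" unfolding r_def by (metis (mono_tags, lifting) LeastI_ex)+
  have least: "r \<le> l" if "prime l" "l dvd n" for l
    unfolding r_def using that by (intro Least_le) auto
  have "odd r" using r(2) n(1) dvd_trans by blast
  then have r3: "r \<ge> 3" using prime_ge_2_nat[OF r(1)] by (cases "r = 2") auto
  \<comment> \<open>Compositeness gives \<open>2 * r \<le> n\<close>. The bound makes
    \<open>r + 1\<close> the remainder in the division of \<open>q\<close> by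
    \<open>n\<close>.\<close>
  have rn: "r + 1 < n"
  proof -
    obtain k where k: "n = r * k" using r(2) by (elim dvdE)
    have "k \<noteq> 0" "k \<noteq> 1" using k n r by (auto intro!: Nat.gr0I)
    then have "r * 2 \<le> n" unfolding k by (intro mult_le_mono2) auto
    then show ?thesis using r3 by simp
  qed
  define a where "a = multiplicity r n"
  have a: "r ^ a dvd n" unfolding a_def by (rule multiplicity_dvd)
  have n0: "n \<noteq> 0" "fact n \<noteq> (0::nat)" using n by auto
  have unit: "\<not> is_unit r" using r(1) by auto
  define b where "b = multiplicity r (fact n :: nat)"
  obtain c where c: "fact n = r ^ b * c" "\<not> r dvd c"
    using multiplicity_decompose'[OF n0(2) unit] unfolding b_def by blast
  have cop_c: "coprime c (r ^ a)"
    using c(2) r(1) prime_imp_coprime[of r c] by (simp add: coprime_commute)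
  \<comment> \<open>The factor \<open>n\<close> fixes the remainder of \<open>q\<close>; the rest
    fixes \<open>q div n\<close> modulo \<open>r ^ a\<close>. The power \<open>r ^ b\<close> of
    \<open>r\<close> in \<open>fact n\<close> is what \<open>cong_binomial\<close> consumes, leaving
    the modulus \<open>r ^ a\<close>.\<close>
  define M where "M = n * (r ^ b * r ^ a)"
  have M0: "M > 0" using n r(1) by (simp add: M_def prime_gt_0_nat)
  have "coprime (r + 1) n"
  proof (rule ccontr)
    assume "\<not> coprime (r + 1) n"
    then obtain l where l: "prime l" "l dvd r + 1" "l dvd n"
      using prime_factor_nat[of "gcd (r + 1) n"] coprime_iff_gcd_eq_1[of "r + 1" n] by auto
    have "r \<le> l" using least l by blast
    moreover have "l \<le> r + 1" using l(2) by (intro dvd_imp_le) auto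
    moreover have "l \<noteq> r"
    proof
      assume "l = r"
      then have "r dvd 1" using l(2) by (metis dvd_add_right_iff dvd_refl)
      then show False using unit by simp
    qed
    ultimately have "l = r + 1" by simp
    then have "even l" using \<open>odd r\<close> by simp
    then show False using l(3) n(1) dvd_trans by blast
  qed
  then have cop: "coprime (n + (r + 1)) n"
    by (metis coprime_iff_gcd_eq_1 gcd_add1 add.commute)
  then have "coprime (n + (r + 1)) r" using r(2) by (rule coprime_divisors[OF dvd_refl, rotated])
  then have "coprime (n + (r + 1)) M" using cop by (simp add: M_def)
  then obtain q where q: "prime q" "[q = n + (r + 1)] (mod M)" "q > n + (r + 1)"
    using prime_in_progression[OF M0] by blast
  have "M dvd q - (n + (r + 1))"
    using q(2,3) by (simp add: cong_altdef_nat cong_sym_eq)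
  then obtain t where "q - (n + (r + 1)) = M * t" by (elim dvdE)
  then have t: "q = n + (r + 1) + M * t" using q(3) by simp
  have "q = n * (1 + r ^ b * r ^ a * t) + (r + 1)"
    unfolding t M_def by (simp add: algebra_simps)
  then have div: "q div n = 1 + r ^ b * r ^ a * t"
    by (simp only: div_mult_self4[OF n0(1)] div_less[OF rn] add_0_right)
  have "[n + (r + 1) choose n = n div r + 1] (mod r ^ a)"
    by (rule binomial_prime_factor_cong[OF r(1) a r(2)])
  moreover have "[q choose n = n + (r + 1) choose n] (mod r ^ a)"
  proof (rule cong_binomial[OF c(1) cop_c])
    show "[q = n + (r + 1)] (mod r ^ b * r ^ a)"
      using q(2) unfolding M_def by (rule cong_dvd_modulus_nat) simp
  qed (use q(3) r(1) in \<open>auto simp: prime_gt_0_nat\<close>)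
  ultimately have choose: "[q choose n = n div r + 1] (mod r ^ a)" using cong_trans by blast
  have not: "\<not> [q choose n = q div n] (mod n)"
  proof
    assume "[q choose n = q div n] (mod n)"
    then have "[q choose n = 1 + r ^ b * r ^ a * t] (mod r ^ a)"
      unfolding div using a by (rule cong_dvd_modulus_nat)
    moreover have "[1 + r ^ b * r ^ a * t = 1 + 0] (mod r ^ a)"
      by (intro cong_add cong_refl) (simp add: cong_0_iff)
    ultimately have "[n div r + 1 = 0 + 1] (mod r ^ a)"
      using choose cong_trans cong_sym by (metis add.commute)
    then have "r ^ a dvd n div r" unfolding cong_add_rcancel_nat by (simp add: cong_0_iff)
    then have "r * r ^ a dvd r * (n div r)" by (rule mult_dvd_mono[OF dvd_refl])
    then have "r ^ Suc a dvd n" using r(2) by simp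
    then have "Suc a \<le> multiplicity r n" using n0 unit by (intro multiplicity_geI) auto
    then show False by (simp add: a_def)
  qed
  show ?thesis using that q(1) not by blast
qed

theorem theorem2p4:
  fixes p :: nat
  assumes "p > 1"
  shows "prime p \<longleftrightarrow>
         (\<forall>q::nat. prime q \<longrightarrow>
            int p dvd (int (q choose p) - \<lfloor>real q / real p\<rfloor>))"
proof -
  have dvd_iff: "int p dvd (int (q choose p) - \<lfloor>real q / real p\<rfloor>) \<longleftrightarrow> [q choose p = q div p] (mod p)" for q
    by (simp add: floor_divide_of_nat_eq cong_iff_dvd_diff flip: cong_int_iff)
  have "\<exists>q. prime q \<and> \<not> [q choose p = q div p] (mod p)" if "\<not> prime p"
  proof (cases "even p")
    case True
    then have "p > 2" using assms that by (cases "p = 2") auto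
    then show ?thesis using even_binomial_div_counterexample[OF True] by blast
  next
    case False
    then show ?thesis using odd_binomial_div_counterexample[OF False assms that] by blast
  qed
  then show ?thesis unfolding dvd_iff using prime_binomial_cong_div by blast
qed

end
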